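(* Fix $A>0$. If $\{e_k\}_{k=0}^{n} \subset L^2(\mathbb{R})$ is an orthonormal sequence such that for $k=0,\ldots,n$, $$|\mu(e_k)|,\ |\mu(\widehat{e_k})|,\ \Delta(e_k),\ \Delta(\widehat{e_k})\leq A,$$ then $n\leq 8\pi A^2$.
   Context: The Fourier transform is $\widehat{f}(\xi)=\int f(t)e^{-2i\pi t\xi}\,dt$ for $f\in L^1(\mathbb{R})$, extended to $L^2(\mathbb{R})$ as usual. For $f\in L^2(\mathbb{R})$ with $\|f\|_2=1$, the mean is $\mu(f)=\int t|f(t)|^2\,dt$, the variance is $\Delta^2(f)=\int|t-\mu(f)|^2|f(t)|^2\,dt$, and the dispersion is $\Delta(f)=\sqrt{\Delta^2(f)}$. The hypothesis includes that these quantities are well defined and finite for the functions considered. *)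

theory Defs
  imports "HOL-Analysis.Analysis"
begin

text \<open>Elements of \<open>L\<^sup>2(\<real>)\<close> are represented by Borel functions; equality almost everywhere
  is not quotiented out, and no notion below depends on the chosen representative.\<close>

definition L2_fun :: "(real \<Rightarrow> complex) set" where
  "L2_fun = {f \<in> borel_measurable lborel. integrable lborel (\<lambda>t. (cmod (f t))\<^sup>2)}"

definition L2_inner :: "(real \<Rightarrow> complex) \<Rightarrow> (real \<Rightarrow> complex) \<Rightarrow> complex" where
  "L2_inner f g = (LINT t|lborel. f t * cnj (g t))"

text \<open>The squared distance is a Lebesgue integral with values in \<open>[0, \<infinity>]\<close>, so that, unlike for the
  Bochner integral, divergence is not recorded as \<open>0\<close>.\<close>

definition L2_tendsto :: "(nat \<Rightarrow> real \<Rightarrow> complex) \<Rightarrow> (real \<Rightarrow> complex) \<Rightarrow> bool" where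
  "L2_tendsto F f \<longleftrightarrow>
     (\<lambda>j. \<integral>\<^sup>+ t. ennreal ((cmod (F j t - f t))\<^sup>2) \<partial>lborel) \<longlonglongrightarrow> 0"

definition fourier_L1 :: "(real \<Rightarrow> complex) \<Rightarrow> real \<Rightarrow> complex" where
  "fourier_L1 f \<xi> =
     (LINT t|lborel. f t * exp (- 2 * \<i> * of_real pi * of_real t * of_real \<xi>))"

text \<open>The extension from \<open>L\<^sup>1 \<inter> L\<^sup>2\<close> to \<open>L\<^sup>2\<close> by density. By Plancherel's theorem every \<open>f\<close> in
  \<open>L\<^sup>2\<close> has such a \<open>g\<close>, unique up to equality almost everywhere, and \<open>fourier_L2\<close> picks a
  representative of it.\<close>

definition has_fourier_L2 :: "(real \<Rightarrow> complex) \<Rightarrow> (real \<Rightarrow> complex) \<Rightarrow> bool" where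
  "has_fourier_L2 f g \<longleftrightarrow> g \<in> L2_fun \<and>
     (\<exists>F. (\<forall>j. F j \<in> L2_fun \<and> integrable lborel (F j)) \<and>
          L2_tendsto F f \<and> L2_tendsto (\<lambda>j. fourier_L1 (F j)) g)"

definition fourier_L2 :: "(real \<Rightarrow> complex) \<Rightarrow> real \<Rightarrow> complex" where
  "fourier_L2 f = (SOME g. has_fourier_L2 f g)"

definition L2_mean :: "(real \<Rightarrow> complex) \<Rightarrow> real" where
  "L2_mean f = (LINT t|lborel. t * (cmod (f t))\<^sup>2)"

definition L2_variance :: "(real \<Rightarrow> complex) \<Rightarrow> real" where
  "L2_variance f = (LINT t|lborel. \<bar>t - L2_mean f\<bar>\<^sup>2 * (cmod (f t))\<^sup>2)"

definition dispersion :: "(real \<Rightarrow> complex) \<Rightarrow> real" where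
  "dispersion f = sqrt (L2_variance f)"

text \<open>Mean and variance are well defined and finite. This has to be stated separately, because the
  Bochner integral of a non-integrable function is \<open>0\<close>.\<close>

definition finite_mean_variance :: "(real \<Rightarrow> complex) \<Rightarrow> bool" where
  "finite_mean_variance f \<longleftrightarrow>
     integrable lborel (\<lambda>t. t * (cmod (f t))\<^sup>2) \<and>
     integrable lborel (\<lambda>t. \<bar>t - L2_mean f\<bar>\<^sup>2 * (cmod (f t))\<^sup>2)"

end

theory Submission
  imports Defs "HOL-Probability.Characteristic_Functions"
begin

text \<open>Coherent states. Let \<open>g\<close> be the \<open>L\<^sup>2\<close>-normalised Gaussian that equals its own Fourier transform,
  \<open>V\<^sub>k(q, p)\<close> the Fourier transform of \<open>t \<mapsto> e\<^sub>k(t) g(t - q)\<close> at \<open>p\<close>, and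
  \<open>Q = \<Sum>\<^sub>k |V\<^sub>k|\<^sup>2\<close>. Plancherel gives \<open>\<integral>\<integral> Q = n + 1\<close>, and, since \<open>|V\<^sub>k|\<close> can equally be computed from
  the Fourier transform of \<open>e\<^sub>k\<close>, both \<open>\<integral>\<integral> q\<^sup>2 |V\<^sub>k|\<^sup>2\<close> and \<open>\<integral>\<integral> p\<^sup>2 |V\<^sub>k|\<^sup>2\<close> are at most
  \<open>2 A\<^sup>2 + 1 / (4 \<pi>)\<close>, the last summand being the variance of \<open>|g|\<^sup>2\<close>. By Bessel's inequality \<open>Q \<le> 1\<close>, so \<open>Q\<close> has at least the
  second moment of the indicator function of the disc of area \<open>n + 1\<close>, which is \<open>(n + 1)\<^sup>2 / (2 \<pi>)\<close>. Comparing both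
  bounds on the second moment gives \<open>n + 1 \<le> 8 \<pi> A\<^sup>2 + 1\<close>.\<close>

section \<open>Square-integrable functions\<close>

text \<open>Kept in \<open>ennreal\<close>, so that estimates and limits need no integrability
  proof; for Borel functions, finiteness is membership in \<open>L2_fun\<close>.\<close>

definition L2_nsq :: "(real \<Rightarrow> complex) \<Rightarrow> ennreal" where
  "L2_nsq f = (\<integral>\<^sup>+ t. ennreal ((cmod (f t))\<^sup>2) \<partial>lborel)"

lemma L2_fun_iff: "f \<in> L2_fun \<longleftrightarrow> f \<in> borel_measurable borel \<and> L2_nsq f < \<infinity>"
  by (auto simp: L2_fun_def L2_nsq_def integrable_iff_bounded)

lemma L2_fun_measurable [measurable_dest]: "f \<in> L2_fun \<Longrightarrow> f \<in> borel_measurable borel"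
  by (simp add: L2_fun_iff)

lemma L2_nsq_eq_integral:
  assumes "f \<in> L2_fun"
  shows "L2_nsq f = ennreal (LINT t|lborel. (cmod (f t))\<^sup>2)"
  using assms unfolding L2_nsq_def L2_fun_def by (intro nn_integral_eq_integral) auto

text \<open>A substitute for the triangle inequality without square roots, from (x + y)^2 \<le> 2
  x^2 + 2 y^2. The factors 2 determine the constants in the approximation arguments below.\<close>

lemma L2_nsq_add_le:
  assumes [measurable]: "f \<in> borel_measurable borel" "g \<in> borel_measurable borel"
  shows "L2_nsq (\<lambda>t. f t + g t) \<le> 2 * L2_nsq f + 2 * L2_nsq g"
proof -
  have "(cmod (f t + g t))\<^sup>2 \<le> 2 * (cmod (f t))\<^sup>2 + 2 * (cmod (g t))\<^sup>2" for t
  proof -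
    have "(cmod (f t + g t))\<^sup>2 \<le> (cmod (f t) + cmod (g t))\<^sup>2"
      by (intro power_mono norm_triangle_ineq) auto
    also have "\<dots> \<le> 2 * (cmod (f t))\<^sup>2 + 2 * (cmod (g t))\<^sup>2"
      using sum_squares_bound[of "cmod (f t)" "cmod (g t)"] by (simp add: power2_sum)
    finally show ?thesis .
  qed
  then have "L2_nsq (\<lambda>t. f t + g t) \<le>
      (\<integral>\<^sup>+ t. 2 * ennreal ((cmod (f t))\<^sup>2) + 2 * ennreal ((cmod (g t))\<^sup>2) \<partial>lborel)"
    unfolding L2_nsq_def
    by (intro nn_integral_mono) (auto simp flip: ennreal_plus ennreal_mult' ennreal_numeral intro!: ennreal_leI)
  also have "\<dots> = 2 * L2_nsq f + 2 * L2_nsq g"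
    unfolding L2_nsq_def by (simp add: nn_integral_add nn_integral_cmult)
  finally show ?thesis .
qed

lemma L2_nsq_minus: "L2_nsq (\<lambda>t. f t - g t) = L2_nsq (\<lambda>t. g t - f t)"
  by (simp add: L2_nsq_def norm_minus_commute)

lemma L2_nsq_diff_trans:
  assumes [measurable]: "f \<in> borel_measurable borel" "g \<in> borel_measurable borel" "h \<in> borel_measurable borel"
  shows "L2_nsq (\<lambda>t. f t - h t) \<le> 2 * L2_nsq (\<lambda>t. f t - g t) + 2 * L2_nsq (\<lambda>t. g t - h t)"
  using L2_nsq_add_le[of "\<lambda>t. f t - g t" "\<lambda>t. g t - h t"] by simp

lemma L2_fun_add:
  assumes "f \<in> L2_fun" "g \<in> L2_fun"
  shows "(\<lambda>t. f t + g t) \<in> L2_fun"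
proof -
  note [measurable] = assms[THEN L2_fun_measurable]
  have "2 * L2_nsq f + 2 * L2_nsq g < \<infinity>"
    using assms by (simp add: L2_fun_iff ennreal_mult_less_top)
  then show ?thesis
    using L2_nsq_add_le[of f g] by (auto simp: L2_fun_iff intro: le_less_trans)
qed

lemma L2_fun_cmult:
  assumes "f \<in> L2_fun"
  shows "(\<lambda>t. c * f t) \<in> L2_fun"
  using assms by (auto simp: L2_fun_def norm_mult power_mult_distrib)

lemma L2_fun_diff:
  assumes "f \<in> L2_fun" "g \<in> L2_fun"
  shows "(\<lambda>t. f t - g t) \<in> L2_fun"
  using L2_fun_add[OF assms(1) L2_fun_cmult[OF assms(2), of "-1"]] by simp

lemma borel_measurable_cnj [measurable]:
  assumes "f \<in> borel_measurable M"
  shows "(\<lambda>x. cnj (f x)) \<in> borel_measurable M"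
  by (intro borel_measurable_continuous_on[OF _ assms] continuous_intros)

lemma L2_fun_cnj:
  assumes "f \<in> L2_fun"
  shows "(\<lambda>t. cnj (f t)) \<in> L2_fun"
proof -
  note [measurable] = assms[THEN L2_fun_measurable]
  show ?thesis using assms by (auto simp: L2_fun_def)
qed

lemma L2_fun_translate:
  assumes "f \<in> L2_fun"
  shows "(\<lambda>t. f (t + u)) \<in> L2_fun"
proof -
  note [measurable] = assms[THEN L2_fun_measurable]
  have "integrable lborel (\<lambda>t. (cmod (f (u + 1 * t)))\<^sup>2)"
    using assms by (intro lborel_integrable_real_affine) (auto simp: L2_fun_def)
  then show ?thesis by (simp add: L2_fun_def add.commute)
qed

lemma L2_nsq_translate:
  assumes [measurable]: "f \<in> borel_measurable borel"
  shows "L2_nsq (\<lambda>t. f (t + u)) = L2_nsq f"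
  unfolding L2_nsq_def
  using nn_integral_real_affine[of "\<lambda>t. ennreal ((cmod (f t))\<^sup>2)" 1 u] by (simp add: add.commute)

section \<open>The bilinear pairing of square-integrable functions\<close>

lemma L2_mult_integrable:
  assumes "f \<in> L2_fun" "g \<in> L2_fun"
  shows "integrable lborel (\<lambda>t. f t * g t)"
proof -
  note [measurable] = assms[THEN L2_fun_measurable]
  have le: "norm (f t * g t) \<le> norm ((cmod (f t))\<^sup>2 + (cmod (g t))\<^sup>2)" for t
    using sum_squares_bound[of "cmod (f t)" "cmod (g t)"]
      mult_nonneg_nonneg[OF norm_ge_zero norm_ge_zero, of "f t" "g t"]
    unfolding norm_mult real_norm_def by linarith
  have "integrable lborel (\<lambda>t. (cmod (f t))\<^sup>2 + (cmod (g t))\<^sup>2)"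
    using assms by (auto simp: L2_fun_def)
  then show ?thesis
    by (rule Bochner_Integration.integrable_bound) (measurable, use le in blast)
qed

lemma L2_Cauchy_Schwarz:
  assumes "f \<in> L2_fun" "g \<in> L2_fun"
  shows "ennreal ((cmod (LINT t|lborel. f t * g t))\<^sup>2) \<le> L2_nsq f * L2_nsq g"
proof -
  note [measurable] = assms[THEN L2_fun_measurable]
  have "ennreal (cmod (LINT t|lborel. f t * g t)) \<le> (\<integral>\<^sup>+ t. ennreal (cmod (f t * g t)) \<partial>lborel)"
    by (rule integral_norm_bound_ennreal[OF L2_mult_integrable[OF assms]])
  also have "\<dots> = (\<integral>\<^sup>+ t. ennreal (cmod (f t)) * ennreal (cmod (g t)) \<partial>lborel)"
    by (simp add: norm_mult ennreal_mult)
  finally have "(ennreal (cmod (LINT t|lborel. f t * g t)))\<^sup>2 \<le>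
      (\<integral>\<^sup>+ t. ennreal (cmod (f t)) * ennreal (cmod (g t)) \<partial>lborel)\<^sup>2"
    by (intro power_mono) auto
  also have "\<dots> \<le> (\<integral>\<^sup>+ t. (ennreal (cmod (f t)))\<^sup>2 \<partial>lborel) * (\<integral>\<^sup>+ t. (ennreal (cmod (g t)))\<^sup>2 \<partial>lborel)"
    by (intro Cauchy_Schwarz_nn_integral) auto
  finally show ?thesis
    by (simp add: L2_nsq_def ennreal_power)
qed

lemma L2_tendsto_iff: "L2_tendsto F f \<longleftrightarrow> (\<lambda>j. L2_nsq (\<lambda>t. F j t - f t)) \<longlonglongrightarrow> 0"
  by (simp add: L2_tendsto_def L2_nsq_def)

text \<open>Cauchy-Schwarz, applied to \<open>F j\<close> minus \<open>f\<close>. The continuity of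
  \<open>autocorr\<close> and the multiplication formula on L^2 both rest on it.\<close>

lemma L2_tendsto_integral_mult:
  assumes F: "\<And>j. F j \<in> L2_fun" and f: "f \<in> L2_fun" and h: "h \<in> L2_fun" and lim: "L2_tendsto F f"
  shows "(\<lambda>j. LINT t|lborel. F j t * h t) \<longlonglongrightarrow> (LINT t|lborel. f t * h t)"
proof -
  have "(\<lambda>j. ennreal ((cmod ((LINT t|lborel. F j t * h t) - (LINT t|lborel. f t * h t)))\<^sup>2)) \<longlonglongrightarrow> 0"
  proof (rule tendsto_sandwich[OF _ _ tendsto_const])
    have "(\<lambda>j. L2_nsq (\<lambda>t. F j t - f t) * L2_nsq h) \<longlonglongrightarrow> 0 * L2_nsq h"
      using lim h unfolding L2_tendsto_iff L2_fun_iff by (intro tendsto_mult_ennreal tendsto_const) auto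
    then show "(\<lambda>j. L2_nsq (\<lambda>t. F j t - f t) * L2_nsq h) \<longlonglongrightarrow> 0" by simp
    have "(LINT t|lborel. F j t * h t) - (LINT t|lborel. f t * h t) =
        (LINT t|lborel. (F j t - f t) * h t)" for j
      using Bochner_Integration.integral_diff[OF L2_mult_integrable[OF F h] L2_mult_integrable[OF f h]]
      by (simp add: left_diff_distrib)
    then show "\<forall>\<^sub>F j in sequentially.
        ennreal ((cmod ((LINT t|lborel. F j t * h t) - (LINT t|lborel. f t * h t)))\<^sup>2)
          \<le> L2_nsq (\<lambda>t. F j t - f t) * L2_nsq h"
      using L2_Cauchy_Schwarz[OF L2_fun_diff[OF F f] h] by simp
  qed simp
  then have "(\<lambda>j. (cmod ((LINT t|lborel. F j t * h t) - (LINT t|lborel. f t * h t)))\<^sup>2) \<longlonglongrightarrow> 0"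
    by (simp add: ennreal_tendsto_0_iff)
  then have "(\<lambda>j. (LINT t|lborel. F j t * h t) - (LINT t|lborel. f t * h t)) \<longlonglongrightarrow> 0"
    by (drule_tac tendsto_real_sqrt) (simp add: tendsto_norm_zero_iff)
  then show ?thesis by (simp add: LIM_zero_iff)
qed

section \<open>Continuity of translation\<close>

text \<open>Two approximations, each by dominated convergence. First \<open>f\<close> is made
  bounded and compactly supported; then it is replaced by continuous functions that converge to it
  almost everywhere, truncated in the same way to have a common bound and support.\<close>

lemma continuous_compact_support_approx:
  assumes f: "f \<in> L2_fun" and \<delta>: "\<delta> > 0"
  shows "\<exists>h M R. continuous_on UNIV h \<and> (\<forall>t. cmod (h t) \<le> M) \<and> (\<forall>t. \<bar>t\<bar> > R \<longrightarrow> h t = 0) \<and>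
           L2_nsq (\<lambda>t. f t - h t) \<le> ennreal \<delta>"
proof -
  note [measurable] = f[THEN L2_fun_measurable]
  \<comment> \<open>\<open>clip n\<close> is the radial retraction onto the disc of radius
    \<open>n\<close>; \<open>\<phi> n\<close> is a cutoff equal to 1 on [-n, n] and to 0 outside
    [-n-1, n+1]. Both are continuous, so the truncation preserves continuity.\<close>
  define clip where "clip n z = (real n / max (real n) (cmod z)) *\<^sub>R z" for n :: nat and z
  define \<phi> where "\<phi> n t = max 0 (min 1 (real n + 1 - \<bar>t\<bar>))" for n :: nat and t
  have clip_le: "cmod (clip n z) \<le> real n" for n z
    by (auto simp: clip_def divide_simps max_def mult_le_cancel_left)
  have clip_le': "cmod (clip n z) \<le> cmod z" for n z
    by (auto simp: clip_def divide_simps max_def mult_right_mono)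
  have clip_eq: "clip n z = z" if "cmod z \<le> real n" "n > 0" for n z
    using that by (auto simp: clip_def max_def)
  have clip_cont: "continuous_on UNIV (clip n)" for n
  proof (cases "n = 0")
    case False
    then show ?thesis unfolding clip_def by (intro continuous_intros) (auto simp: max_def)
  qed (simp add: clip_def)
  have \<phi>_cont: "continuous_on UNIV (\<phi> n)" for n
    unfolding \<phi>_def by (intro continuous_intros)
  have \<phi>_bd: "0 \<le> \<phi> n t" "\<phi> n t \<le> 1" for n t by (auto simp: \<phi>_def)
  have \<phi>_0: "\<phi> n t = 0" if "\<bar>t\<bar> > real n + 1" for n t using that by (auto simp: \<phi>_def)
  have \<phi>_1: "\<phi> n t = 1" if "\<bar>t\<bar> \<le> real n" for n t using that by (auto simp: \<phi>_def)
  have [measurable]: "clip n \<in> borel_measurable borel" "\<phi> n \<in> borel_measurable borel" for n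
    using clip_cont \<phi>_cont by (auto intro: borel_measurable_continuous_onI)
  define F where "F n t = \<phi> n t *\<^sub>R clip n (f t)" for n t
  have "(\<lambda>n. \<integral>\<^sup>+ t. ennreal ((cmod (f t - F n t))\<^sup>2) \<partial>lborel) \<longlonglongrightarrow> (\<integral>\<^sup>+ (t::real). 0 \<partial>lborel)"
  proof (rule nn_integral_dominated_convergence[where w="\<lambda>t. 4 * ennreal ((cmod (f t))\<^sup>2)"])
    have "cmod (F n t) \<le> cmod (f t)" for n t
      using mult_mono[OF \<phi>_bd(2)[of n t] clip_le'[of n "f t"]] \<phi>_bd[of n t] by (simp add: F_def)
    then have "cmod (f t - F n t) \<le> 2 * cmod (f t)" for n t
      using norm_triangle_ineq4[of "f t" "F n t"] by (smt (verit))
    then have "(cmod (f t - F n t))\<^sup>2 \<le> (2 * cmod (f t))\<^sup>2" for n t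
      by (intro power_mono) auto
    then show "AE t in lborel. ennreal ((cmod (f t - F n t))\<^sup>2) \<le> 4 * ennreal ((cmod (f t))\<^sup>2)" for n
      by (auto simp flip: ennreal_mult' ennreal_numeral intro!: ennreal_leI simp: power_mult_distrib)
    show "(\<integral>\<^sup>+ t. 4 * ennreal ((cmod (f t))\<^sup>2) \<partial>lborel) < \<infinity>"
      using f by (simp add: nn_integral_cmult L2_fun_iff L2_nsq_def ennreal_mult_less_top)
    show "AE t in lborel. (\<lambda>n. ennreal ((cmod (f t - F n t))\<^sup>2)) \<longlonglongrightarrow> 0"
    proof (rule AE_I2)
      fix t
      \<comment> \<open>From \<open>N\<close> on, \<open>t\<close> and \<open>f t\<close> lie where
        cutoff and clipping change nothing; the 1 in the maximum ensures \<open>n > 0\<close>, as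
        \<open>clip_eq\<close> asks.\<close>
      obtain N where N: "max 1 (max \<bar>t\<bar> (cmod (f t))) \<le> real N" using real_arch_simple by blast
      have "f t - F n t = 0" if "n \<ge> N" for n
      proof -
        have "real N \<le> real n" using that by simp
        with N have "\<bar>t\<bar> \<le> real n" "cmod (f t) \<le> real n" "n > 0" by (auto simp del: of_nat_le_iff)
        then show ?thesis by (simp add: F_def \<phi>_1 clip_eq)
      qed
      then have "\<forall>\<^sub>F n in sequentially. ennreal ((cmod (f t - F n t))\<^sup>2) = 0"
        by (intro eventually_sequentiallyI[of N]) simp
      then show "(\<lambda>n. ennreal ((cmod (f t - F n t))\<^sup>2)) \<longlonglongrightarrow> 0"
        by (rule tendsto_eventually)
    qed
  qed (auto simp: F_def)
  then have "(\<lambda>n. L2_nsq (\<lambda>t. f t - F n t)) \<longlonglongrightarrow> 0" by (simp add: L2_nsq_def)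
  \<comment> \<open>Both errors are brought below \<delta>/4, since each enters the final estimate
    with a factor 2.\<close>
  then have "\<forall>\<^sub>F n in sequentially. L2_nsq (\<lambda>t. f t - F n t) < ennreal (\<delta> / 4)"
    using \<delta> by (intro order_tendstoD) auto
  then obtain n where n: "L2_nsq (\<lambda>t. f t - F n t) < ennreal (\<delta> / 4)"
    by (auto simp: eventually_sequentially)
  \<comment> \<open>A Lebesgue measurable function is, off a negligible set, the pointwise limit of
    continuous functions \<open>g k\<close>.\<close>
  have "f \<in> borel_measurable lebesgue" by (intro measurable_completion) simp
  then have "f measurable_on UNIV" using lebesgue_measurable_imp_measurable_on[of f UNIV] by simp
  then obtain N g where N: "negligible N" and g: "\<And>k. continuous_on UNIV (g k)"
    and "\<forall>t. t \<notin> N \<longrightarrow> (\<lambda>k. g k t) \<longlonglongrightarrow> (if t \<in> UNIV then f t else 0)"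
    unfolding measurable_on_def by (elim exE conjE) (rule that, auto)
  then have lim: "(\<lambda>k. g k t) \<longlonglongrightarrow> f t" if "t \<notin> N" for t using that by simp
  define G where "G k t = \<phi> n t *\<^sub>R clip n (g k t)" for k :: nat and t
  have G_cont: "continuous_on UNIV (G k)" for k
    unfolding G_def
    by (intro continuous_intros \<phi>_cont continuous_on_compose2[OF clip_cont g]) auto
  have [measurable]: "G k \<in> borel_measurable borel" for k
    using G_cont by (rule borel_measurable_continuous_onI)
  have [measurable]: "F n \<in> borel_measurable borel"
    unfolding F_def by measurable
  have G_le: "cmod (G k t) \<le> real n" for k t
    using mult_mono[OF \<phi>_bd(2)[of n t] clip_le[of n "g k t"]] \<phi>_bd[of n t] by (simp add: G_def)
  have F_le: "cmod (F n t) \<le> real n" for t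
    using mult_mono[OF \<phi>_bd(2)[of n t] clip_le[of n "f t"]] \<phi>_bd[of n t] by (simp add: F_def)
  \<comment> \<open>\<open>N\<close> is null for the completed measure; almost-everywhere statements
    are the same for it and for \<open>lborel\<close>.\<close>
  have AEN: "AE t in lborel. t \<notin> N"
    using N AE_not_in[of N lebesgue] by (simp only: negligible_iff_null_sets AE_completion_iff)
  have "(\<lambda>k. \<integral>\<^sup>+ t. ennreal ((cmod (F n t - G k t))\<^sup>2) \<partial>lborel) \<longlonglongrightarrow> (\<integral>\<^sup>+ (t::real). 0 \<partial>lborel)"
  proof (rule nn_integral_dominated_convergence[where
        w="\<lambda>t. ennreal ((2 * real n)\<^sup>2) * indicator {- (real n + 1)..real n + 1} t"])
    have "cmod (F n t - G k t) \<le> 2 * real n" for k t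
      using norm_triangle_ineq4[of "F n t" "G k t"] F_le[of t] G_le[of k t] by linarith
    then have "(cmod (F n t - G k t))\<^sup>2 \<le> (2 * real n)\<^sup>2" for k t
      by (intro power_mono) auto
    moreover have "F n t - G k t = 0" if "t \<notin> {- (real n + 1)..real n + 1}" for k t
    proof -
      have "\<bar>t\<bar> > real n + 1" using that by (auto simp: abs_if)
      then show ?thesis by (simp add: F_def G_def \<phi>_0)
    qed
    ultimately show "AE t in lborel. ennreal ((cmod (F n t - G k t))\<^sup>2) \<le>
        ennreal ((2 * real n)\<^sup>2) * indicator {- (real n + 1)..real n + 1} t" for k
      by (auto intro!: ennreal_leI split: split_indicator)
    show "(\<integral>\<^sup>+ t. ennreal ((2 * real n)\<^sup>2) * indicator {- (real n + 1)..real n + 1} t \<partial>lborel) < \<infinity>"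
      by (simp add: nn_integral_cmult ennreal_mult_less_top)
    show "AE t in lborel. (\<lambda>k. ennreal ((cmod (F n t - G k t))\<^sup>2)) \<longlonglongrightarrow> 0"
      using AEN
    proof eventually_elim
      fix t assume "t \<notin> N"
      have "isCont (clip n) (f t)" using clip_cont continuous_on_eq_continuous_at by blast
      then have "(\<lambda>k. G k t) \<longlonglongrightarrow> F n t"
        unfolding G_def F_def
        by (intro tendsto_scaleR tendsto_const isCont_tendsto_compose[OF _ lim[OF \<open>t \<notin> N\<close>]])
      then have "(\<lambda>k. (cmod (F n t - G k t))\<^sup>2) \<longlonglongrightarrow> (cmod (F n t - F n t))\<^sup>2"
        by (intro tendsto_intros)
      then show "(\<lambda>k. ennreal ((cmod (F n t - G k t))\<^sup>2)) \<longlonglongrightarrow> 0"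
        by (simp add: ennreal_tendsto_0_iff)
    qed
  qed auto
  then have "(\<lambda>k. L2_nsq (\<lambda>t. F n t - G k t)) \<longlonglongrightarrow> 0" by (simp add: L2_nsq_def)
  then have "\<forall>\<^sub>F k in sequentially. L2_nsq (\<lambda>t. F n t - G k t) < ennreal (\<delta> / 4)"
    using \<delta> by (intro order_tendstoD) auto
  then obtain k where k: "L2_nsq (\<lambda>t. F n t - G k t) < ennreal (\<delta> / 4)"
    by (auto simp: eventually_sequentially)
  have "L2_nsq (\<lambda>t. f t - G k t) \<le> 2 * L2_nsq (\<lambda>t. f t - F n t) + 2 * L2_nsq (\<lambda>t. F n t - G k t)"
    by (intro L2_nsq_diff_trans) auto
  also have "\<dots> \<le> 2 * ennreal (\<delta> / 4) + 2 * ennreal (\<delta> / 4)"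
    using n k by (intro add_mono mult_left_mono) auto
  also have "\<dots> = ennreal \<delta>"
    using \<delta> by (simp flip: ennreal_mult' ennreal_plus ennreal_numeral)
  finally have "L2_nsq (\<lambda>t. f t - G k t) \<le> ennreal \<delta>" .
  moreover have "G k t = 0" if "\<bar>t\<bar> > real n + 1" for t using that by (simp add: G_def \<phi>_0)
  ultimately show ?thesis using G_cont G_le by blast
qed

lemma L2_nsq_translate_tendsto_continuous:
  assumes h: "continuous_on UNIV h" and M: "\<And>t. cmod (h t) \<le> M" and R: "\<And>t. \<bar>t\<bar> > R \<Longrightarrow> h t = 0"
    and u: "u \<longlonglongrightarrow> 0"
  shows "(\<lambda>j. L2_nsq (\<lambda>t. h (t + u j) - h t)) \<longlonglongrightarrow> 0"
proof -
  have [measurable]: "h \<in> borel_measurable borel"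
    using h by (rule borel_measurable_continuous_onI)
  \<comment> \<open>A bound on all shifts keeps every translate supported in one compact interval,
    which provides the dominating function.\<close>
  obtain B where B: "\<And>j. \<bar>u j\<bar> \<le> B"
    using convergent_imp_Bseq[OF convergentI[OF u]] by (auto simp: Bseq_def)
  then have "B \<ge> 0" by (meson abs_ge_zero order_trans)
  have "(\<lambda>j. \<integral>\<^sup>+ t. ennreal ((cmod (h (t + u j) - h t))\<^sup>2) \<partial>lborel) \<longlonglongrightarrow> (\<integral>\<^sup>+ (t::real). 0 \<partial>lborel)"
  proof (rule nn_integral_dominated_convergence[where
        w="\<lambda>t. ennreal ((2 * M)\<^sup>2) * indicator {- (R + B)..R + B} t"])
    have "cmod (h (t + u j) - h t) \<le> 2 * M" for j t
      using norm_triangle_ineq4[of "h (t + u j)" "h t"] M[of t] M[of "t + u j"] by linarith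
    then have "(cmod (h (t + u j) - h t))\<^sup>2 \<le> (2 * M)\<^sup>2" for j t
      by (intro power_mono) auto
    moreover have "h (t + u j) - h t = 0" if "t \<notin> {- (R + B)..R + B}" for j t
    proof -
      have "\<bar>t\<bar> > R" "\<bar>t + u j\<bar> > R" using that B[of j] \<open>B \<ge> 0\<close> by (auto simp: abs_if split: if_splits)
      then show ?thesis by (simp add: R)
    qed
    ultimately show "AE t in lborel. ennreal ((cmod (h (t + u j) - h t))\<^sup>2) \<le>
        ennreal ((2 * M)\<^sup>2) * indicator {- (R + B)..R + B} t" for j
      by (auto intro!: ennreal_leI split: split_indicator)
    show "(\<integral>\<^sup>+ t. ennreal ((2 * M)\<^sup>2) * indicator {- (R + B)..R + B} t \<partial>lborel) < \<infinity>"
      by (simp add: nn_integral_cmult ennreal_mult_less_top emeasure_lborel_Icc_eq)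
    show "AE t in lborel. (\<lambda>j. ennreal ((cmod (h (t + u j) - h t))\<^sup>2)) \<longlonglongrightarrow> 0"
    proof (rule AE_I2)
      fix t
      have "isCont h t" using h continuous_on_eq_continuous_at by blast
      moreover have "(\<lambda>j. t + u j) \<longlonglongrightarrow> t" using tendsto_add[OF tendsto_const u, of t] by simp
      ultimately have "(\<lambda>j. h (t + u j)) \<longlonglongrightarrow> h t" by (rule isCont_tendsto_compose)
      then have "(\<lambda>j. (cmod (h (t + u j) - h t))\<^sup>2) \<longlonglongrightarrow> (cmod (h t - h t))\<^sup>2"
        by (intro tendsto_intros)
      then show "(\<lambda>j. ennreal ((cmod (h (t + u j) - h t))\<^sup>2)) \<longlonglongrightarrow> 0"
        by (simp add: ennreal_tendsto_0_iff)
    qed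
  qed auto
  then show ?thesis by (simp add: L2_nsq_def)
qed

text \<open>Density: \<open>f\<close> is replaced by a continuous compactly supported
  \<open>h\<close>. Translation preserves the norm, so the error is equally small before and after
  the shift.\<close>

lemma L2_nsq_translate_tendsto:
  assumes f: "f \<in> L2_fun" and u: "u \<longlonglongrightarrow> 0"
  shows "(\<lambda>j. L2_nsq (\<lambda>t. f (t + u j) - f t)) \<longlonglongrightarrow> 0"
proof (rule order_tendstoI)
  note [measurable] = f[THEN L2_fun_measurable]
  fix a :: ennreal assume "a > 0"
  \<comment> \<open>An \<epsilon> strictly between 0 and \<open>a\<close> is real even when
    \<open>a\<close> is infinite, and turns the non-strict estimates below into a strict
    one.\<close>
  then obtain b where b: "0 < b" "b < a" using dense by blast
  then have "b < top" by (meson top_greatest order_less_le_trans)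
  then obtain \<epsilon> where \<epsilon>: "b = ennreal \<epsilon>" "\<epsilon> > 0"
    using b by (cases b) (auto simp: ennreal_less_zero_iff)
  \<comment> \<open>In the estimate below the error of \<open>h\<close> occurs 2 + 4 times and the
    shift of \<open>h\<close> 4 times: 6 \<epsilon>/12 + 4 \<epsilon>/8 = \<epsilon>.\<close>
  obtain h M R where h: "continuous_on UNIV h" "\<And>t. cmod (h t) \<le> M" "\<And>t. \<bar>t\<bar> > R \<Longrightarrow> h t = 0"
    and fh: "L2_nsq (\<lambda>t. f t - h t) \<le> ennreal (\<epsilon> / 12)"
    using continuous_compact_support_approx[OF f, of "\<epsilon> / 12"] \<epsilon> by auto
  have [measurable]: "h \<in> borel_measurable borel"
    using h(1) by (rule borel_measurable_continuous_onI)
  have "\<forall>\<^sub>F j in sequentially. L2_nsq (\<lambda>t. h (t + u j) - h t) < ennreal (\<epsilon> / 8)"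
    using L2_nsq_translate_tendsto_continuous[OF h u] \<epsilon> by (intro order_tendstoD) auto
  then show "\<forall>\<^sub>F j in sequentially. L2_nsq (\<lambda>t. f (t + u j) - f t) < a"
  proof eventually_elim
    fix j assume j: "L2_nsq (\<lambda>t. h (t + u j) - h t) < ennreal (\<epsilon> / 8)"
    let ?d = "L2_nsq (\<lambda>t. f t - h t)"
    have "L2_nsq (\<lambda>t. f (t + u j) - f t) \<le>
        2 * L2_nsq (\<lambda>t. f (t + u j) - h (t + u j)) + 2 * L2_nsq (\<lambda>t. h (t + u j) - f t)"
      by (intro L2_nsq_diff_trans) auto
    also have "L2_nsq (\<lambda>t. f (t + u j) - h (t + u j)) = ?d"
      by (rule L2_nsq_translate[of "\<lambda>t. f t - h t"]) auto
    also have "L2_nsq (\<lambda>t. h (t + u j) - f t) \<le> 2 * L2_nsq (\<lambda>t. h (t + u j) - h t) + 2 * L2_nsq (\<lambda>t. h t - f t)"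
      by (intro L2_nsq_diff_trans) auto
    also have "L2_nsq (\<lambda>t. h t - f t) = ?d" by (rule L2_nsq_minus)
    also have "2 * ?d + 2 * (2 * L2_nsq (\<lambda>t. h (t + u j) - h t) + 2 * ?d) =
       6 * ?d + 4 * L2_nsq (\<lambda>t. h (t + u j) - h t)"
      by (simp add: distrib_left mult.assoc[symmetric] add.commute add.left_commute flip: distrib_right)
    also have "\<dots> \<le> 6 * ennreal (\<epsilon> / 12) + 4 * ennreal (\<epsilon> / 8)"
      using fh j by (intro add_mono mult_left_mono) auto
    also have "\<dots> = ennreal \<epsilon>"
      using \<epsilon> by (simp flip: ennreal_mult' ennreal_plus ennreal_numeral)
    finally show "L2_nsq (\<lambda>t. f (t + u j) - f t) < a"
      using b \<epsilon> by (auto simp: mult_left_mono)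
  qed
qed simp

section \<open>Fourier transform of integrable functions\<close>

text \<open>The kernel of \<open>fourier_L1\<close>, sign included, written with \<open>cis\<close>
  so that modulus and addition law are immediate.\<close>

definition echar :: "real \<Rightarrow> complex" where
  "echar x = cis (- (2 * pi * x))"

lemma echar_0 [simp]: "echar 0 = 1"
  by (simp add: echar_def)

lemma norm_echar [simp]: "cmod (echar x) = 1"
  by (simp add: echar_def)

lemma echar_add: "echar (x + y) = echar x * echar y"
  by (simp add: echar_def cis_mult algebra_simps)

lemma cnj_echar: "cnj (echar x) = echar (- x)"
  by (simp add: echar_def cis_cnj)

lemma borel_measurable_echar [measurable]: "echar \<in> borel_measurable borel"
  unfolding echar_def by (intro borel_measurable_continuous_onI continuous_intros)

lemma fourier_L1_echar: "fourier_L1 f \<xi> = (LINT t|lborel. f t * echar (t * \<xi>))"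
  unfolding fourier_L1_def echar_def cis_conv_exp
  by (intro Bochner_Integration.integral_cong refl) (simp add: algebra_simps)

lemma integrable_mult_echar:
  assumes "integrable lborel f" and [measurable]: "g \<in> borel_measurable borel"
  shows "integrable lborel (\<lambda>t. f t * echar (g t))"
proof -
  have [measurable]: "f \<in> borel_measurable borel" using assms(1) by auto
  show ?thesis
    by (rule Bochner_Integration.integrable_bound[OF assms(1)]) (auto simp: norm_mult)
qed

lemma borel_measurable_fourier_L1:
  assumes [measurable]: "f \<in> borel_measurable borel"
  shows "fourier_L1 f \<in> borel_measurable borel"
proof -
  have "(\<lambda>\<xi>. LINT t|lborel. f t * echar (t * \<xi>)) \<in> borel_measurable borel"
    by (rule lborel.borel_measurable_lebesgue_integral) measurable
  then show ?thesis by (simp add: fourier_L1_echar[abs_def])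
qed

lemma fourier_L1_bound: "cmod (fourier_L1 f \<xi>) \<le> (LINT t|lborel. cmod (f t))"
  unfolding fourier_L1_echar
  by (rule order_trans[OF integral_norm_bound]) (simp add: norm_mult)

lemma integrable_fourier_L1_mult:
  assumes f: "integrable lborel f" and h: "integrable lborel h"
  shows "integrable lborel (\<lambda>\<xi>. fourier_L1 f \<xi> * h \<xi>)"
proof -
  have [measurable]: "f \<in> borel_measurable borel" "h \<in> borel_measurable borel" using f h by auto
  note [measurable] = borel_measurable_fourier_L1
  have "integrable lborel (\<lambda>\<xi>. (LINT t|lborel. cmod (f t)) * cmod (h \<xi>))"
    using h by simp
  then show ?thesis
    by (rule Bochner_Integration.integrable_bound)
      (measurable, auto simp: norm_mult abs_mult fourier_L1_bound intro!: mult_right_mono AE_I2 order_trans[OF fourier_L1_bound abs_ge_self])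
qed

text \<open>Fubini's theorem: \<open>echar\<close> has modulus 1, so the modulus of the double
  integrand is the product of those of \<open>f t\<close> and \<open>h \<xi>\<close>.\<close>

lemma fourier_L1_multiplication:
  assumes f: "integrable lborel f" and h: "integrable lborel h"
  shows "(LINT \<xi>|lborel. fourier_L1 f \<xi> * h \<xi>) = (LINT t|lborel. f t * fourier_L1 h t)"
proof -
  have [measurable]: "f \<in> borel_measurable borel" "h \<in> borel_measurable borel" using f h by auto
  have "integrable (lborel \<Otimes>\<^sub>M lborel) (\<lambda>(t, \<xi>). f t * echar (t * \<xi>) * h \<xi>)"
  proof (rule lborel_pair.Fubini_integrable)
    show "(\<lambda>(t, \<xi>). f t * echar (t * \<xi>) * h \<xi>) \<in> borel_measurable (lborel \<Otimes>\<^sub>M lborel)"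
      by measurable
    show "integrable lborel (\<lambda>t. LINT \<xi>|lborel. norm (case (t, \<xi>) of (t, \<xi>) \<Rightarrow> f t * echar (t * \<xi>) * h \<xi>))"
      using f by (simp add: norm_mult)
    have "integrable lborel (\<lambda>\<xi>. f t * (h \<xi> * echar (t * \<xi>)))" for t
      using h by (intro integrable_mult_right integrable_mult_echar) auto
    then show "AE t in lborel. integrable lborel (\<lambda>\<xi>. case (t, \<xi>) of (t, \<xi>) \<Rightarrow> f t * echar (t * \<xi>) * h \<xi>)"
      by (simp add: ac_simps)
  qed
  from lborel_pair.Fubini_integral[OF this]
  have "(LINT \<xi>|lborel. LINT t|lborel. f t * echar (t * \<xi>) * h \<xi>) =
      (LINT t|lborel. LINT \<xi>|lborel. f t * (h \<xi> * echar (\<xi> * t)))"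
    by (simp add: ac_simps)
  then show ?thesis
    by (simp add: fourier_L1_echar)
qed

section \<open>Gaussians and their Fourier transforms\<close>

definition gauss :: "real \<Rightarrow> real \<Rightarrow> real" where
  "gauss a x = exp (- (pi * a\<^sup>2 * x\<^sup>2))"

lemma borel_measurable_gauss [measurable]: "gauss a \<in> borel_measurable borel"
  unfolding gauss_def by measurable

lemma gauss_pos [simp]: "gauss a x > 0" and gauss_nonneg [simp]: "gauss a x \<ge> 0"
  and gauss_le_1: "gauss a x \<le> 1"
  by (auto simp: gauss_def)

lemma gauss_eq_normal_density:
  assumes "a > 0"
  shows "gauss a = (\<lambda>x. (1 / a) * normal_density 0 (1 / (a * sqrt (2 * pi))) x)"
  using assms
  by (auto simp: fun_eq_iff gauss_def normal_density_def field_simps power_mult_distrib real_sqrt_mult real_sqrt_divide)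

lemma gauss_integrable [simp]: "a > 0 \<Longrightarrow> integrable lborel (gauss a)"
  by (simp add: gauss_eq_normal_density)

lemma gauss_integral: "a > 0 \<Longrightarrow> (LINT x|lborel. gauss a x) = 1 / a"
  by (simp add: gauss_eq_normal_density)

text \<open>Scaling reduces this to the characteristic function of the standard normal distribution.
  With \<pi> in the exponent of \<open>gauss\<close>, the case \<open>a = 1\<close> is a fixed
  point.\<close>

lemma fourier_L1_gauss:
  assumes a: "a > 0"
  shows "fourier_L1 (\<lambda>x. of_real (gauss a x)) \<xi> = of_real ((1 / a) * gauss (1 / a) \<xi>)"
proof -
  \<comment> \<open>Chosen so that x = c y turns \<open>gauss a x\<close> into exp (- y^2 /
    2).\<close>
  define c where "c = 1 / (a * sqrt (2 * pi))"
  have c: "c > 0" using a by (simp add: c_def)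
  have cc: "2 * pi * a\<^sup>2 * c\<^sup>2 = 1" using a by (simp add: c_def power_divide power_mult_distrib)
  have pc: "pi * a\<^sup>2 * (c * y)\<^sup>2 = y\<^sup>2 / 2" for y
    using arg_cong[OF cc, of "\<lambda>z. z * y\<^sup>2 / 2"] by (simp add: power_mult_distrib ac_simps)
  have "fourier_L1 (\<lambda>x. of_real (gauss a x)) \<xi> =
      c *\<^sub>R (LINT y|lborel. of_real (gauss a (c * y)) * echar (c * y * \<xi>))"
    unfolding fourier_L1_echar using c by (subst lborel_integral_real_affine[of c _ 0]) simp_all
  also have "(LINT y|lborel. of_real (gauss a (c * y)) * echar (c * y * \<xi>)) =
      (LINT y|lborel. sqrt (2 * pi) *\<^sub>R (std_normal_density y *\<^sub>R iexp ((- (2 * pi * c * \<xi>)) * y)))"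
  proof (intro Bochner_Integration.integral_cong refl)
    fix y
    have "gauss a (c * y) = sqrt (2 * pi) * std_normal_density y"
      by (simp add: gauss_def pc std_normal_density_def)
    moreover have "echar (c * y * \<xi>) = iexp ((- (2 * pi * c * \<xi>)) * y)"
      by (simp add: echar_def cis_conv_exp algebra_simps)
    ultimately show "of_real (gauss a (c * y)) * echar (c * y * \<xi>) =
        sqrt (2 * pi) *\<^sub>R (std_normal_density y *\<^sub>R iexp ((- (2 * pi * c * \<xi>)) * y))"
      by (simp add: scaleR_conv_of_real)
  qed
  also have "\<dots> = sqrt (2 * pi) *\<^sub>R char std_normal_distribution (- (2 * pi * c * \<xi>))"
    unfolding char_def integral_scaleR_right by (subst integral_density) auto
  also have "\<dots> = sqrt (2 * pi) *\<^sub>R of_real (exp (- ((2 * pi * c * \<xi>)\<^sup>2) / 2))"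
    by (simp add: char_std_normal_distribution)
  also have "- ((2 * pi * c * \<xi>)\<^sup>2) / 2 = - (pi * (1 / a)\<^sup>2 * \<xi>\<^sup>2)"
    using a by (simp add: c_def power_divide power_mult_distrib power2_eq_square)
  finally show ?thesis
    using a by (simp add: gauss_def c_def scaleR_conv_of_real)
qed

text \<open>Translation and modulation change places under the transform; the phase is anchored at
  \<open>p\<close> so that no constant factor remains.\<close>

lemma fourier_L1_translate_modulate:
  "fourier_L1 (\<lambda>\<xi>. f (\<xi> - p) * echar (- (q * (\<xi> - p)))) t = echar (p * t) * fourier_L1 f (t - q)"
proof -
  have "fourier_L1 (\<lambda>\<xi>. f (\<xi> - p) * echar (- (q * (\<xi> - p)))) t =
      (LINT \<xi>|lborel. f \<xi> * echar (- (q * \<xi>)) * echar ((p + \<xi>) * t))"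
    unfolding fourier_L1_echar by (subst lborel_integral_real_affine[of 1 _ p]) simp_all
  also have "\<dots> = (LINT \<xi>|lborel. echar (p * t) * (f \<xi> * echar (\<xi> * (t - q))))"
    by (intro Bochner_Integration.integral_cong refl)
      (simp add: ac_simps flip: echar_add, simp add: algebra_simps)
  finally show ?thesis by (simp add: fourier_L1_echar)
qed

section \<open>Plancherel's theorem\<close>

text \<open>Formally the Fourier transform of the squared modulus of \<open>fourier_L1 f\<close>, so
  its value at 0 should be the squared norm on both sides of Plancherel's theorem.\<close>

definition autocorr :: "(real \<Rightarrow> complex) \<Rightarrow> real \<Rightarrow> complex" where
  "autocorr f u = (LINT s|lborel. f s * cnj (f (s + u)))"

lemma borel_measurable_autocorr:
  assumes [measurable]: "f \<in> borel_measurable borel"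
  shows "autocorr f \<in> borel_measurable borel"
  unfolding autocorr_def by (rule lborel.borel_measurable_lebesgue_integral) measurable

text \<open>Cauchy-Schwarz and translation invariance. The bound is uniform in \<open>u\<close> and
  serves for domination in Plancherel's theorem.\<close>

lemma autocorr_bound:
  assumes f: "f \<in> L2_fun"
  shows "cmod (autocorr f u) \<le> (LINT t|lborel. (cmod (f t))\<^sup>2)"
proof -
  note [measurable] = f[THEN L2_fun_measurable]
  let ?N = "LINT t|lborel. (cmod (f t))\<^sup>2"
  have "L2_nsq (\<lambda>t. cnj (f (t + u))) = L2_nsq f"
    using L2_nsq_translate[of f u] by (simp add: L2_nsq_def)
  then have "ennreal ((cmod (autocorr f u))\<^sup>2) \<le> L2_nsq f * L2_nsq f"
    using L2_Cauchy_Schwarz[OF f L2_fun_cnj[OF L2_fun_translate[OF f, of u]]]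
    by (simp add: autocorr_def)
  also have "\<dots> = ennreal (?N\<^sup>2)"
    using L2_nsq_eq_integral[OF f] by (simp add: power2_eq_square ennreal_mult)
  finally have "(cmod (autocorr f u))\<^sup>2 \<le> ?N\<^sup>2"
    by (simp add: ennreal_le_iff)
  then show ?thesis by (rule power2_le_imp_le) simp
qed

lemma autocorr_0: "autocorr f 0 = of_real (LINT t|lborel. (cmod (f t))\<^sup>2)"
  unfolding autocorr_def add_0_right complex_norm_square[symmetric] by (rule integral_complex_of_real)

text \<open>Inherited from the continuity of translation in L^2.\<close>

lemma autocorr_tendsto:
  assumes f: "f \<in> L2_fun" and u: "u \<longlonglongrightarrow> 0"
  shows "(\<lambda>j. autocorr f (u j)) \<longlonglongrightarrow> autocorr f 0"
proof -
  have "L2_tendsto (\<lambda>j t. cnj (f (t + u j))) (\<lambda>t. cnj (f t))"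
    using L2_nsq_translate_tendsto[OF f u]
    by (simp add: L2_tendsto_iff L2_nsq_def flip: complex_cnj_diff)
  from L2_tendsto_integral_mult[OF _ _ f this]
  show ?thesis
    using f by (simp add: autocorr_def L2_fun_cnj L2_fun_translate mult.commute)
qed

text \<open>The Gaussian factor makes Fubini's theorem applicable; letting \<open>a\<close> tend to \<open>0\<close> gives Plancherel's
  theorem.\<close>

lemma integral_norm_fourier_L1_gauss:
  assumes f: "integrable lborel f" and a: "a > 0"
  shows "(LINT \<xi>|lborel. fourier_L1 f \<xi> * (cnj (fourier_L1 f \<xi>) * of_real (gauss a \<xi>))) =
    (LINT v|lborel. of_real (gauss 1 v) * autocorr f (a * v))"
proof -
  have [measurable]: "f \<in> borel_measurable borel" using f by auto
  note [measurable] = borel_measurable_fourier_L1[of f]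
  have ga: "integrable lborel (\<lambda>\<xi>. complex_of_real (gauss a \<xi>))"
    using a by simp
  have int_k: "integrable lborel (\<lambda>\<xi>. cnj (fourier_L1 f \<xi>) * of_real (gauss a \<xi>))"
    using integrable_cnj[OF integrable_fourier_L1_mult[OF f ga]] by simp
  \<comment> \<open>The multiplication formula against a modulated Gaussian: its transform is a
    Gaussian of width proportional to \<open>a\<close> centred at \<open>s\<close>, and t = s + a v
    brings it to the form \<open>gauss 1 v\<close>.\<close>
  have k: "fourier_L1 (\<lambda>\<xi>. cnj (fourier_L1 f \<xi>) * of_real (gauss a \<xi>)) s =
      (LINT v|lborel. of_real (gauss 1 v) * cnj (f (s + a * v)))" for s
  proof -
    have int_h: "integrable lborel (\<lambda>\<xi>. of_real (gauss a \<xi>) * echar (- (s * \<xi>)))"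
      by (rule integrable_mult_echar[OF ga]) measurable
    have "fourier_L1 (\<lambda>\<xi>. cnj (fourier_L1 f \<xi>) * of_real (gauss a \<xi>)) s =
        (LINT \<xi>|lborel. cnj (fourier_L1 f \<xi> * (of_real (gauss a \<xi>) * echar (- (s * \<xi>)))))"
      unfolding fourier_L1_echar[of _ s] by (simp add: cnj_echar ac_simps)
    also have "\<dots> = cnj (LINT \<xi>|lborel. fourier_L1 f \<xi> * (of_real (gauss a \<xi>) * echar (- (s * \<xi>))))"
      by (rule Bochner_Integration.integral_cnj)
    also have "\<dots> = cnj (LINT t|lborel. f t * fourier_L1 (\<lambda>\<xi>. of_real (gauss a \<xi>) * echar (- (s * \<xi>))) t)"
      by (simp only: fourier_L1_multiplication[OF f int_h])
    also have "\<dots> = cnj (LINT t|lborel. f t * of_real ((1 / a) * gauss (1 / a) (t - s)))"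
      using fourier_L1_translate_modulate[of "\<lambda>x. of_real (gauss a x)" 0 s] fourier_L1_gauss[OF a] by simp
    also have "\<dots> = cnj (a *\<^sub>R (LINT v|lborel. f (s + a * v) * of_real ((1 / a) * gauss (1 / a) (a * v))))"
      using a by (subst lborel_integral_real_affine[of a _ s]) simp_all
    also have "\<dots> = (LINT v|lborel. cnj (a *\<^sub>R (f (s + a * v) * of_real ((1 / a) * gauss (1 / a) (a * v)))))"
      by (simp only: Bochner_Integration.integral_cnj integral_scaleR_right)
    also have "\<dots> = (LINT v|lborel. of_real (gauss 1 v) * cnj (f (s + a * v)))"
      using a by (intro Bochner_Integration.integral_cong refl)
        (simp add: gauss_def power_mult_distrib power_divide scaleR_conv_of_real)
    finally show ?thesis .
  qed
  \<comment> \<open>For integrable \<open>f\<close> the product is absolutely integrable over the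
    plane even without the Gaussian: integrating the modulus of the second factor over v gives 1/a
    times the L^1 norm, whatever \<open>s\<close>. The Gaussian is at most 1.\<close>
  have bound: "integrable (lborel \<Otimes>\<^sub>M lborel) (\<lambda>(s, v). f s * cnj (f (s + a * v)))"
  proof (rule lborel_pair.Fubini_integrable)
    show "(\<lambda>(s, v). f s * cnj (f (s + a * v))) \<in> borel_measurable (lborel \<Otimes>\<^sub>M lborel)"
      by measurable
    have "integrable lborel (\<lambda>v. cnj (f (s + a * v)))" for s
      using lborel_integrable_real_affine[OF f, of a s] a by simp
    then show "AE s in lborel. integrable lborel (\<lambda>v. case (s, v) of (s, v) \<Rightarrow> f s * cnj (f (s + a * v)))"
      by simp
    have "(LINT v|lborel. cmod (f (s + a * v))) = (1 / a) * (LINT t|lborel. cmod (f t))" for s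
      using a lborel_integral_real_affine[of a "\<lambda>t. cmod (f t)" s] by simp
    then show "integrable lborel (\<lambda>s. LINT v|lborel. norm (case (s, v) of (s, v) \<Rightarrow> f s * cnj (f (s + a * v))))"
      using f by (simp add: norm_mult)
  qed
  have int: "integrable (lborel \<Otimes>\<^sub>M lborel) (\<lambda>(s, v). f s * (of_real (gauss 1 v) * cnj (f (s + a * v))))"
  proof (rule Bochner_Integration.integrable_bound[OF bound])
    show "(\<lambda>(s, v). f s * (of_real (gauss 1 v) * cnj (f (s + a * v)))) \<in> borel_measurable (lborel \<Otimes>\<^sub>M lborel)"
      by measurable
    have "cmod (f s) * (gauss 1 v * cmod (f (s + a * v))) \<le> cmod (f s) * cmod (f (s + a * v))" for s v
      using gauss_le_1[of 1 v] by (intro mult_left_mono mult_left_le_one_le) auto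
    then show "AE x in lborel \<Otimes>\<^sub>M lborel. norm (case x of (s, v) \<Rightarrow> f s * (of_real (gauss 1 v) * cnj (f (s + a * v))))
        \<le> norm (case x of (s, v) \<Rightarrow> f s * cnj (f (s + a * v)))"
      by (auto simp: norm_mult)
  qed
  have "(LINT \<xi>|lborel. fourier_L1 f \<xi> * (cnj (fourier_L1 f \<xi>) * of_real (gauss a \<xi>))) =
      (LINT s|lborel. f s * (LINT v|lborel. of_real (gauss 1 v) * cnj (f (s + a * v))))"
    unfolding fourier_L1_multiplication[OF f int_k] k ..
  also have "\<dots> = (LINT s|lborel. LINT v|lborel. f s * (of_real (gauss 1 v) * cnj (f (s + a * v))))"
    by simp
  also have "\<dots> = (LINT v|lborel. LINT s|lborel. f s * (of_real (gauss 1 v) * cnj (f (s + a * v))))"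
    using lborel_pair.Fubini_integral[OF int] by simp
  also have "\<dots> = (LINT v|lborel. LINT s|lborel. of_real (gauss 1 v) * (f s * cnj (f (s + a * v))))"
    by (simp add: ac_simps)
  also have "\<dots> = (LINT v|lborel. of_real (gauss 1 v) * autocorr f (a * v))"
    by (simp add: autocorr_def)
  finally show ?thesis .
qed

theorem Plancherel_L1_L2:
  assumes f1: "integrable lborel f" and f2: "f \<in> L2_fun"
  shows "fourier_L1 f \<in> L2_fun" "L2_nsq (fourier_L1 f) = L2_nsq f"
proof -
  note [measurable] = f2[THEN L2_fun_measurable]
  note [measurable] = borel_measurable_fourier_L1[of f] borel_measurable_autocorr[of f]
  let ?N = "LINT t|lborel. (cmod (f t))\<^sup>2"
  \<comment> \<open>A decreasing sequence, so that \<open>gauss (a j) \<xi>\<close> increases to 1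
    and monotone convergence applies on the frequency side.\<close>
  define a where "a j = inverse (real (Suc j))" for j
  have a_pos: "a j > 0" for j by (simp add: a_def)
  have a_lim: "a \<longlonglongrightarrow> 0" unfolding a_def by (rule LIMSEQ_inverse_real_of_nat)
  have a_anti: "a j \<le> a i" if "i \<le> j" for i j using that by (simp add: a_def)
  define m where "m j \<xi> = (cmod (fourier_L1 f \<xi>))\<^sup>2 * gauss (a j) \<xi>" for j \<xi>
  \<comment> \<open>\<open>fourier_L1 f\<close> is bounded, so two factors of its modulus leave the
    Gaussian integrable.\<close>
  have m_int: "integrable lborel (m j)" for j
  proof -
    have "integrable lborel (\<lambda>\<xi>. fourier_L1 f \<xi> * complex_of_real (gauss (a j) \<xi>))"
      using a_pos by (intro integrable_fourier_L1_mult f1) simp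
    from integrable_fourier_L1_mult[OF f1 integrable_cnj[OF this]]
    have "integrable lborel (\<lambda>\<xi>. complex_of_real (m j \<xi>))"
      by (simp add: m_def complex_norm_square ac_simps del: of_real_power)
    then show ?thesis by (simp add: complex_of_real_integrable_eq)
  qed
  \<comment> \<open>On the time side the limit is by dominated convergence,
    \<open>autocorr f\<close> being bounded and continuous at 0; \<open>gauss 1\<close> has integral
    1.\<close>
  have "(\<lambda>j. LINT v|lborel. of_real (gauss 1 v) * autocorr f (a j * v)) \<longlonglongrightarrow>
      (LINT v|lborel. of_real (gauss 1 v) * autocorr f 0)"
  proof (rule integral_dominated_convergence[where w="\<lambda>v. ?N * gauss 1 v"])
    show "AE v in lborel. (\<lambda>j. of_real (gauss 1 v) * autocorr f (a j * v)) \<longlonglongrightarrow> of_real (gauss 1 v) * autocorr f 0"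
      using autocorr_tendsto[OF f2 tendsto_mult_left_zero[OF a_lim]]
      by (intro AE_I2 tendsto_intros)
    show "AE v in lborel. norm (of_real (gauss 1 v) * autocorr f (a j * v)) \<le> ?N * gauss 1 v" for j
      using autocorr_bound[OF f2] by (auto simp: norm_mult mult.commute intro!: mult_right_mono)
  qed auto
  also have "(LINT v|lborel. of_real (gauss 1 v) * autocorr f 0) = of_real ?N"
    by (simp add: autocorr_0 gauss_integral)
  also have "(\<lambda>j. LINT v|lborel. of_real (gauss 1 v) * autocorr f (a j * v)) = (\<lambda>j. of_real (LINT \<xi>|lborel. m j \<xi>))"
  proof
    fix j
    have "fourier_L1 f \<xi> * (cnj (fourier_L1 f \<xi>) * of_real (gauss (a j) \<xi>)) = of_real (m j \<xi>)" for \<xi>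
      by (simp only: m_def of_real_mult complex_norm_square mult.assoc)
    then show "(LINT v|lborel. of_real (gauss 1 v) * autocorr f (a j * v)) = of_real (LINT \<xi>|lborel. m j \<xi>)"
      unfolding integral_norm_fourier_L1_gauss[OF f1 a_pos, symmetric] by (simp only: integral_complex_of_real)
  qed
  finally have "(\<lambda>j. LINT \<xi>|lborel. m j \<xi>) \<longlonglongrightarrow> ?N"
    by (simp add: tendsto_of_real_iff)
  moreover have "AE \<xi> in lborel. mono (\<lambda>j. m j \<xi>)"
    using a_pos a_anti by (auto intro!: AE_I2 monoI mult_left_mono mult_right_mono power_mono
        simp: m_def gauss_def less_imp_le)
  moreover have "AE \<xi> in lborel. (\<lambda>j. m j \<xi>) \<longlonglongrightarrow> (cmod (fourier_L1 f \<xi>))\<^sup>2"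
  proof (rule AE_I2)
    fix \<xi>
    have "(\<lambda>j. m j \<xi>) \<longlonglongrightarrow> (cmod (fourier_L1 f \<xi>))\<^sup>2 * exp (- (pi * 0\<^sup>2 * \<xi>\<^sup>2))"
      unfolding m_def gauss_def using a_lim by (intro tendsto_intros)
    then show "(\<lambda>j. m j \<xi>) \<longlonglongrightarrow> (cmod (fourier_L1 f \<xi>))\<^sup>2" by simp
  qed
  \<comment> \<open>Monotone convergence delivers the integrability of the limit and the value of
    its integral together.\<close>
  ultimately have *: "has_bochner_integral lborel (\<lambda>\<xi>. (cmod (fourier_L1 f \<xi>))\<^sup>2) ?N"
    using m_int by (intro has_bochner_integral_monotone_convergence[where f=m]) auto
  then show "fourier_L1 f \<in> L2_fun"
    by (auto simp: L2_fun_def has_bochner_integral_iff)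
  with * show "L2_nsq (fourier_L1 f) = L2_nsq f"
    using f2 by (simp add: L2_nsq_eq_integral has_bochner_integral_iff)
qed

section \<open>Fourier transform of square-integrable functions\<close>

lemma fourier_L1_diff:
  assumes "integrable lborel f" "integrable lborel g"
  shows "fourier_L1 (\<lambda>t. f t - g t) \<xi> = fourier_L1 f \<xi> - fourier_L1 g \<xi>"
proof -
  have "integrable lborel (\<lambda>t. f t * echar (t * \<xi>))" "integrable lborel (\<lambda>t. g t * echar (t * \<xi>))"
    using assms by (auto intro!: integrable_mult_echar)
  from Bochner_Integration.integral_diff[OF this] show ?thesis
    by (simp add: fourier_L1_echar left_diff_distrib)
qed

text \<open>The indicator of a bounded interval is itself in L^2, so truncations are integrable as
  products of two L^2 functions. They supply the approximating sequence that
  \<open>has_fourier_L2\<close> asks for.\<close>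

lemma L2_truncation:
  assumes f: "f \<in> L2_fun"
  shows "(\<lambda>t. f t * indicator {-r..r} t) \<in> L2_fun"
    and "integrable lborel (\<lambda>t. f t * indicator {-r..r} t)"
    and "(\<lambda>n. L2_nsq (\<lambda>t. f t * indicator {- real n..real n} t - f t)) \<longlonglongrightarrow> 0"
proof -
  note [measurable] = f[THEN L2_fun_measurable]
  have f2: "integrable lborel (\<lambda>t. (cmod (f t))\<^sup>2)" using f by (simp add: L2_fun_def)
  have "integrable lborel (\<lambda>t. (cmod (f t * indicator {-r..r} t))\<^sup>2)"
    by (rule Bochner_Integration.integrable_bound[OF f2]) (auto split: split_indicator)
  then show "(\<lambda>t. f t * indicator {-r..r} t) \<in> L2_fun" by (simp add: L2_fun_def)
  have "(\<lambda>t. indicator {-r..r} t :: complex) \<in> L2_fun"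
  proof -
    have "(cmod (indicator {-r..r} t))\<^sup>2 = indicator {-r..r} t" for t
      by (auto split: split_indicator)
    then show ?thesis by (simp add: L2_fun_def emeasure_lborel_Icc_eq)
  qed
  then show "integrable lborel (\<lambda>t. f t * indicator {-r..r} t)"
    by (rule L2_mult_integrable[OF f])
  have "(\<lambda>n. \<integral>\<^sup>+ t. ennreal ((cmod (f t * indicator {- real n..real n} t - f t))\<^sup>2) \<partial>lborel) \<longlonglongrightarrow>
      (\<integral>\<^sup>+ (t::real). 0 \<partial>lborel)"
  proof (rule nn_integral_dominated_convergence[where w="\<lambda>t. ennreal ((cmod (f t))\<^sup>2)"])
    show "AE t in lborel. ennreal ((cmod (f t * indicator {- real n..real n} t - f t))\<^sup>2) \<le> ennreal ((cmod (f t))\<^sup>2)" for n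
      by (auto split: split_indicator)
    show "(\<integral>\<^sup>+ t. ennreal ((cmod (f t))\<^sup>2) \<partial>lborel) < \<infinity>"
      using f by (simp add: L2_fun_iff L2_nsq_def)
    show "AE t in lborel. (\<lambda>n. ennreal ((cmod (f t * indicator {- real n..real n} t - f t))\<^sup>2)) \<longlonglongrightarrow> 0"
    proof (intro AE_I2 tendsto_eventually)
      fix t
      obtain N where "\<bar>t\<bar> \<le> real N" using real_arch_simple by blast
      then have "t \<in> {- real n..real n}" if "n \<ge> N" for n
        using of_nat_mono[OF that, where ?'a=real] by auto
      then show "\<forall>\<^sub>F n in sequentially. ennreal ((cmod (f t * indicator {- real n..real n} t - f t))\<^sup>2) = 0"
        by (intro eventually_sequentiallyI[of N]) simp
    qed
  qed auto
  then show "(\<lambda>n. L2_nsq (\<lambda>t. f t * indicator {- real n..real n} t - f t)) \<longlonglongrightarrow> 0"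
    by (simp add: L2_nsq_def)
qed

text \<open>Fatou's lemma. The bound is asked for from \<open>j\<close> on, the form in which a
  Cauchy estimate supplies it.\<close>

lemma L2_nsq_le_liminf:
  assumes [measurable]: "\<And>m. H m \<in> borel_measurable borel"
    and lim: "AE t in lborel. (\<lambda>m. H m t) \<longlonglongrightarrow> h t"
    and bound: "\<And>m. m \<ge> j \<Longrightarrow> L2_nsq (H m) \<le> c"
  shows "L2_nsq h \<le> c"
proof -
  have "L2_nsq h = (\<integral>\<^sup>+ t. liminf (\<lambda>m. ennreal ((cmod (H m t))\<^sup>2)) \<partial>lborel)"
    unfolding L2_nsq_def
  proof (rule nn_integral_cong_AE, use lim in eventually_elim)
    fix t assume "(\<lambda>m. H m t) \<longlonglongrightarrow> h t"
    then have "(\<lambda>m. ennreal ((cmod (H m t))\<^sup>2)) \<longlonglongrightarrow> ennreal ((cmod (h t))\<^sup>2)"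
      by (intro tendsto_ennrealI tendsto_intros)
    then show "ennreal ((cmod (h t))\<^sup>2) = liminf (\<lambda>m. ennreal ((cmod (H m t))\<^sup>2))"
      by (intro lim_imp_Liminf[symmetric]) auto
  qed
  also have "\<dots> \<le> liminf (\<lambda>m. L2_nsq (H m))"
    unfolding L2_nsq_def by (intro nn_integral_liminf) auto
  also have "\<dots> \<le> liminf (\<lambda>m. c)"
    using bound by (intro Liminf_mono eventually_sequentiallyI[of j]) auto
  finally show ?thesis by (simp add: Liminf_const)
qed

text \<open>The Riesz-Fischer argument. Even weighted by 4^j, the squared increments have summable
  integrals; so at almost every point the weighted series is finite, the increments are O((1/2)^j),
  and they are summable.\<close>

lemma L2_fast_Cauchy_AE_convergent:
  assumes [measurable]: "\<And>j. G j \<in> borel_measurable borel"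
    and bound: "\<And>j. L2_nsq (\<lambda>\<xi>. G (Suc j) \<xi> - G j \<xi>) \<le> ennreal (4 * (1 / 16) ^ j)"
  shows "AE \<xi> in lborel. convergent (\<lambda>j. G j \<xi>)"
proof -
  define S where "S \<xi> = (\<Sum>j. ennreal (4 ^ j * (cmod (G (Suc j) \<xi> - G j \<xi>))\<^sup>2))" for \<xi>
  have [measurable]: "S \<in> borel_measurable borel" unfolding S_def by measurable
  have "(\<integral>\<^sup>+ \<xi>. S \<xi> \<partial>lborel) = (\<Sum>j. \<integral>\<^sup>+ \<xi>. ennreal (4 ^ j * (cmod (G (Suc j) \<xi> - G j \<xi>))\<^sup>2) \<partial>lborel)"
    unfolding S_def by (rule nn_integral_suminf) auto
  also have "\<dots> \<le> (\<Sum>j. ennreal (4 * (1 / 4) ^ j))"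
  proof (rule suminf_le)
    fix j
    have "(\<integral>\<^sup>+ \<xi>. ennreal (4 ^ j * (cmod (G (Suc j) \<xi> - G j \<xi>))\<^sup>2) \<partial>lborel) =
        ennreal (4 ^ j) * L2_nsq (\<lambda>\<xi>. G (Suc j) \<xi> - G j \<xi>)"
      unfolding L2_nsq_def by (simp add: ennreal_mult' nn_integral_cmult del: ennreal_power)
    also have "\<dots> \<le> ennreal (4 ^ j) * ennreal (4 * (1 / 16) ^ j)"
      by (intro mult_left_mono bound) auto
    also have "\<dots> = ennreal (4 * (1 / 4) ^ j)"
      by (subst ennreal_mult[symmetric]) (auto simp: power_divide power_mult_distrib[symmetric] field_simps simp flip: power_mult_distrib)
    finally show "(\<integral>\<^sup>+ \<xi>. ennreal (4 ^ j * (cmod (G (Suc j) \<xi> - G j \<xi>))\<^sup>2) \<partial>lborel) \<le> ennreal (4 * (1 / 4) ^ j)" .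
  qed auto
  also have "\<dots> < top"
    unfolding less_top[symmetric]
    by (rule ennreal_suminf_neq_top) (auto intro!: summable_mult summable_geometric)
  finally have "(\<integral>\<^sup>+ \<xi>. S \<xi> \<partial>lborel) \<noteq> \<infinity>" by (auto simp: top_unique)
  then have "AE \<xi> in lborel. S \<xi> \<noteq> \<infinity>" by (intro nn_integral_noteq_infinite) auto
  then show ?thesis
  proof eventually_elim
    fix \<xi> assume "S \<xi> \<noteq> \<infinity>"
    then obtain C where C: "S \<xi> = ennreal C" "C \<ge> 0" by (cases "S \<xi>") auto
    have le: "norm (G (Suc j) \<xi> - G j \<xi>) \<le> sqrt C * (1 / 2) ^ j" for j
    proof -
      define T where "T i = ennreal (4 ^ i * (cmod (G (Suc i) \<xi> - G i \<xi>))\<^sup>2)" for i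
      have "sum T {j} \<le> suminf T" by (rule sum_le_suminf) auto
      also have "suminf T = ennreal C" unfolding C(1)[symmetric] S_def T_def ..
      finally have "T j \<le> ennreal C" by simp
      then have "4 ^ j * (cmod (G (Suc j) \<xi> - G j \<xi>))\<^sup>2 \<le> C"
        using C by (simp add: T_def)
      moreover have "(4::real) ^ j = (2 ^ j)\<^sup>2" by (simp add: power2_eq_square flip: power_mult_distrib)
      ultimately have "(2 ^ j * cmod (G (Suc j) \<xi> - G j \<xi>))\<^sup>2 \<le> C"
        by (simp add: power_mult_distrib)
      then have "2 ^ j * cmod (G (Suc j) \<xi> - G j \<xi>) \<le> sqrt C"
        by (rule real_le_rsqrt)
      then show ?thesis by (simp add: field_simps power_divide)
    qed
    have "summable (\<lambda>j. sqrt C * (1 / 2) ^ j)"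
      by (intro summable_mult summable_geometric) simp
    then have "summable (\<lambda>j. G (Suc j) \<xi> - G j \<xi>)"
      by (rule summable_comparison_test') (rule le)
    then have "convergent (\<lambda>n. G n \<xi> - G 0 \<xi>)"
      by (simp add: summable_iff_convergent sum_lessThan_telescope[of "\<lambda>n. G n \<xi>"])
    from convergent_add[OF this convergent_const[of "G 0 \<xi>"]]
    show "convergent (\<lambda>j. G j \<xi>)" by simp
  qed
qed

text \<open>Truncations of \<open>f\<close> are chosen to converge fast; by Plancherel's theorem
  their transforms are then fast Cauchy. These converge almost everywhere, and Fatou's lemma shows
  that the pointwise limit is also the limit in L^2.\<close>

theorem has_fourier_L2_exists:
  assumes f: "f \<in> L2_fun"
  shows "\<exists>g. has_fourier_L2 f g"
proof -
  note [measurable] = f[THEN L2_fun_measurable]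
  have "\<exists>n. L2_nsq (\<lambda>t. f t * indicator {- real n..real n} t - f t) \<le> ennreal ((1 / 16) ^ j)" for j
  proof -
    have "\<forall>\<^sub>F n in sequentially. L2_nsq (\<lambda>t. f t * indicator {- real n..real n} t - f t) < ennreal ((1 / 16) ^ j)"
      by (rule order_tendstoD(2)[OF L2_truncation(3)[OF f]]) simp
    then show ?thesis by (auto simp: eventually_sequentially intro: less_imp_le)
  qed
  then obtain N where N: "\<And>j. L2_nsq (\<lambda>t. f t * indicator {- real (N j)..real (N j)} t - f t) \<le> ennreal ((1 / 16) ^ j)"
    by metis
  define F where "F j t = f t * indicator {- real (N j)..real (N j)} t" for j t
  have F_L2: "F j \<in> L2_fun" and F_L1: "integrable lborel (F j)" for j
    unfolding F_def using L2_truncation[OF f] by auto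
  have [measurable]: "F j \<in> borel_measurable borel" for j using F_L2 by (rule L2_fun_measurable)
  have F_f: "L2_nsq (\<lambda>t. F j t - f t) \<le> ennreal ((1 / 16) ^ j)" for j
    using N by (simp add: F_def)
  define G where "G j = fourier_L1 (F j)" for j
  have [measurable]: "G j \<in> borel_measurable borel" for j
    unfolding G_def by (intro borel_measurable_fourier_L1) simp
  \<comment> \<open>The factor 4 comes from passing through \<open>f\<close>: twice (1/16)^m plus
    twice (1/16)^j, with m \<ge> j.\<close>
  have G_diff: "L2_nsq (\<lambda>\<xi>. G m \<xi> - G j \<xi>) \<le> ennreal (4 * (1 / 16) ^ j)" if "j \<le> m" for j m
  proof -
    have "L2_nsq (\<lambda>\<xi>. G m \<xi> - G j \<xi>) = L2_nsq (\<lambda>t. F m t - F j t)"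
      unfolding G_def fourier_L1_diff[OF F_L1 F_L1, symmetric]
      by (intro Plancherel_L1_L2 Bochner_Integration.integrable_diff F_L1 L2_fun_diff F_L2)
    also have "\<dots> \<le> 2 * L2_nsq (\<lambda>t. F m t - f t) + 2 * L2_nsq (\<lambda>t. f t - F j t)"
      by (intro L2_nsq_diff_trans) auto
    also have "\<dots> \<le> 2 * ennreal ((1 / 16) ^ m) + 2 * ennreal ((1 / 16) ^ j)"
      using F_f L2_nsq_minus[of f "F j"] by (intro add_mono mult_left_mono) auto
    also have "\<dots> \<le> 2 * ennreal ((1 / 16) ^ j) + 2 * ennreal ((1 / 16) ^ j)"
      using that by (intro add_mono mult_left_mono ennreal_leI power_decreasing) auto
    also have "\<dots> = ennreal (4 * (1 / 16) ^ j)"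
      by (simp flip: ennreal_mult' ennreal_plus ennreal_numeral)
    finally show ?thesis .
  qed
  define g where "g \<xi> = lim (\<lambda>j. G j \<xi>)" for \<xi>
  have [measurable]: "g \<in> borel_measurable borel"
    unfolding g_def by (intro borel_measurable_lim_metric) auto
  have conv: "AE \<xi> in lborel. (\<lambda>m. G m \<xi>) \<longlonglongrightarrow> g \<xi>"
    using L2_fast_Cauchy_AE_convergent[of G, OF _ G_diff] by (simp add: g_def convergent_LIMSEQ_iff)
  \<comment> \<open>The limit m \<rightarrow> \<infinity> in \<open>G_diff\<close>.\<close>
  have g_diff: "L2_nsq (\<lambda>\<xi>. g \<xi> - G j \<xi>) \<le> ennreal (4 * (1 / 16) ^ j)" for j
  proof (rule L2_nsq_le_liminf[OF _ _ G_diff])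
    show "AE \<xi> in lborel. (\<lambda>m. G m \<xi> - G j \<xi>) \<longlonglongrightarrow> g \<xi> - G j \<xi>"
      using conv by eventually_elim (intro tendsto_intros)
  qed auto
  have G_L2: "G j \<in> L2_fun" for j unfolding G_def by (rule Plancherel_L1_L2[OF F_L1 F_L2])
  have "L2_nsq (\<lambda>\<xi>. g \<xi> - G 0 \<xi>) < \<infinity>"
    using g_diff[of 0] by (simp add: order_le_less_trans)
  then have "(\<lambda>\<xi>. g \<xi> - G 0 \<xi>) \<in> L2_fun" by (simp add: L2_fun_iff)
  from L2_fun_add[OF this G_L2[of 0]] have "g \<in> L2_fun" by simp
  moreover have "L2_tendsto F f"
    unfolding L2_tendsto_iff
  proof (rule tendsto_sandwich[OF _ _ tendsto_const])
    show "(\<lambda>j. ennreal ((1 / 16) ^ j)) \<longlonglongrightarrow> 0"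
      by (simp add: ennreal_tendsto_0_iff LIMSEQ_power_zero)
  qed (auto simp: F_f)
  moreover have "L2_tendsto G g"
    unfolding L2_tendsto_iff
  proof (rule tendsto_sandwich[OF _ _ tendsto_const])
    have "(\<lambda>j. 4 * (1 / 16) ^ j :: real) \<longlonglongrightarrow> 4 * 0"
      by (intro tendsto_mult tendsto_const LIMSEQ_power_zero) auto
    then show "(\<lambda>j. ennreal (4 * (1 / 16) ^ j)) \<longlonglongrightarrow> 0"
      by (simp add: ennreal_tendsto_0_iff)
  qed (use g_diff L2_nsq_minus[of g] in auto)
  ultimately show ?thesis
    using F_L2 F_L1 unfolding has_fourier_L2_def G_def by blast
qed

lemma has_fourier_L2_fourier_L2: "f \<in> L2_fun \<Longrightarrow> has_fourier_L2 f (fourier_L2 f)"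
  unfolding fourier_L2_def using has_fourier_L2_exists by (rule someI_ex)

text \<open>Both sides of the multiplication formula pass to the limit along the sequence that
  defines \<open>g\<close>. The identity holds for every representative, so the one picked by
  \<open>fourier_L2\<close> is covered.\<close>

lemma has_fourier_L2_multiplication:
  assumes f: "f \<in> L2_fun" and g: "has_fourier_L2 f g"
    and h1: "integrable lborel h" and h2: "h \<in> L2_fun"
  shows "(LINT \<xi>|lborel. g \<xi> * h \<xi>) = (LINT t|lborel. f t * fourier_L1 h t)"
proof -
  obtain F where F: "\<And>j. F j \<in> L2_fun" "\<And>j. integrable lborel (F j)"
    and lim: "L2_tendsto F f" "L2_tendsto (\<lambda>j. fourier_L1 (F j)) g" and g2: "g \<in> L2_fun"
    using g unfolding has_fourier_L2_def by blast
  have "(\<lambda>j. LINT \<xi>|lborel. fourier_L1 (F j) \<xi> * h \<xi>) \<longlonglongrightarrow> (LINT \<xi>|lborel. g \<xi> * h \<xi>)"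
    by (intro L2_tendsto_integral_mult Plancherel_L1_L2 F g2 h2 lim)
  moreover have "(\<lambda>j. LINT t|lborel. F j t * fourier_L1 h t) \<longlonglongrightarrow> (LINT t|lborel. f t * fourier_L1 h t)"
    by (intro L2_tendsto_integral_mult Plancherel_L1_L2 F f h1 h2 lim)
  ultimately show ?thesis
    unfolding fourier_L1_multiplication[OF F(2) h1] by (rule LIMSEQ_unique)
qed

section \<open>Short-time Fourier transform with Gaussian window\<close>

text \<open>The square of \<open>gauss 1\<close> has integral 1 / sqrt 2, whence the factor 2^(1/4)
  for unit norm. As \<open>gauss 1\<close> is its own transform, the window looks the same in time
  and in frequency.\<close>

definition gwin :: "real \<Rightarrow> real" where
  "gwin t = sqrt (sqrt 2) * gauss 1 t"

lemma borel_measurable_gwin [measurable]: "gwin \<in> borel_measurable borel"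
  unfolding gwin_def by measurable

lemma gwin_nonneg: "gwin t \<ge> 0"
  by (simp add: gwin_def)

lemma gwin_le: "gwin t \<le> sqrt (sqrt 2)"
  using gauss_le_1[of 1 t] by (simp add: gwin_def mult_left_le)

text \<open>As a function of \<open>q\<close> the squared window is a probability density of mean
  \<open>t\<close> and variance 1/(4 \<pi>), which makes the known normal moments available.\<close>

lemma gwin_sq: "(gwin (t - q))\<^sup>2 = normal_density t (1 / (2 * sqrt pi)) q"
proof -
  have "(gwin (t - q))\<^sup>2 = sqrt 2 * exp (- (2 * pi * (q - t)\<^sup>2))"
    by (simp add: gwin_def gauss_def power_mult_distrib power2_commute[of t q] flip: exp_double)
  moreover have "sqrt (2 * pi * (1 / (2 * sqrt pi))\<^sup>2) = 1 / sqrt 2"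
    by (simp add: power_mult_distrib power_divide real_sqrt_divide)
  ultimately show ?thesis
    by (simp add: normal_density_def power_mult_distrib power_divide field_simps)
qed

lemma nn_integral_gwin_sq: "(\<integral>\<^sup>+ q. ennreal ((gwin (t - q))\<^sup>2) \<partial>lborel) = 1"
  unfolding gwin_sq by (subst nn_integral_eq_integral) auto

text \<open>Squared mean plus variance, from q^2 = (q - t)^2 + 2 t q - t^2.\<close>

lemma nn_integral_second_moment_gwin_sq:
  "(\<integral>\<^sup>+ q. ennreal (q\<^sup>2) * ennreal ((gwin (t - q))\<^sup>2) \<partial>lborel) = ennreal (t\<^sup>2 + 1 / (4 * pi))"
proof -
  define \<sigma> where "\<sigma> = 1 / (2 * sqrt pi)"
  have \<sigma>: "\<sigma> > 0" "\<sigma>\<^sup>2 = 1 / (4 * pi)"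
    by (auto simp: \<sigma>_def power_divide power_mult_distrib)
  let ?d = "normal_density t \<sigma>"
  have "has_bochner_integral lborel (\<lambda>q. ?d q * (q - t)\<^sup>2) (\<sigma>\<^sup>2)"
    using normal_moment_even[OF \<sigma>(1), of t 1] by (simp add: fact_numeral)
  moreover have "has_bochner_integral lborel (\<lambda>q. 2 * t * (?d q * q)) (2 * t * t)"
    by (intro has_bochner_integral_mult_right normal_moment_nz_1 \<sigma>)
  moreover have "has_bochner_integral lborel (\<lambda>q. t\<^sup>2 * ?d q) (t\<^sup>2 * 1)"
    using \<sigma>(1) by (intro has_bochner_integral_mult_right) (auto simp: has_bochner_integral_iff)
  ultimately have "has_bochner_integral lborel (\<lambda>q. ?d q * (q - t)\<^sup>2 + 2 * t * (?d q * q) - t\<^sup>2 * ?d q)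
      (\<sigma>\<^sup>2 + 2 * t * t - t\<^sup>2 * 1)"
    by (intro has_bochner_integral_diff has_bochner_integral_add)
  moreover have "?d q * (q - t)\<^sup>2 + 2 * t * (?d q * q) - t\<^sup>2 * ?d q = q\<^sup>2 * ?d q" for q
    by (simp add: power2_eq_square algebra_simps)
  ultimately have "has_bochner_integral lborel (\<lambda>q. q\<^sup>2 * ?d q) (t\<^sup>2 + 1 / (4 * pi))"
    using \<sigma>(2) by (simp add: power2_eq_square)
  then show ?thesis
    unfolding gwin_sq \<sigma>_def[symmetric]
    by (subst ennreal_mult[symmetric])
      (auto simp: has_bochner_integral_iff nn_integral_eq_integral)
qed

lemma fourier_L1_gwin: "fourier_L1 (\<lambda>t. of_real (gwin t)) \<xi> = of_real (gwin \<xi>)"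
proof -
  have "fourier_L1 (\<lambda>t. of_real (gwin t)) \<xi> = of_real (sqrt (sqrt 2)) * fourier_L1 (\<lambda>t. of_real (gauss 1 t)) \<xi>"
    by (simp add: fourier_L1_echar gwin_def mult.assoc)
  then show ?thesis by (simp add: fourier_L1_gauss gwin_def)
qed

text \<open>The affine phase covers all time-frequency shifts that occur; \<open>d\<close> absorbs
  the constant phase in \<open>STFT_fourier\<close>.\<close>

lemma gwin_L2: "(\<lambda>t. of_real (gwin (t - q)) * echar (c * t + d)) \<in> L2_fun"
proof -
  have "(\<lambda>t. complex_of_real (gwin (t - 0))) \<in> L2_fun"
    using nn_integral_gwin_sq[of 0] nn_integral_real_affine[of "\<lambda>t. ennreal ((gwin t)\<^sup>2)" "-1" 0]
    by (simp add: L2_fun_iff L2_nsq_def)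
  from L2_fun_translate[OF this, of "-q"]
  show ?thesis by (auto simp: L2_fun_def norm_mult)
qed

lemma gwin_L1: "integrable lborel (\<lambda>t. complex_of_real (gwin (t - q)) * echar (c * t + d))"
proof -
  have "integrable lborel (\<lambda>t. complex_of_real (gwin t))"
    unfolding gwin_def by (intro integrable_of_real integrable_mult_right gauss_integrable) simp
  from lborel_integrable_real_affine[OF this, of 1 "-q"]
  have "integrable lborel (\<lambda>t. complex_of_real (gwin (t - q)))" by simp
  then show ?thesis by (rule integrable_mult_echar) measurable
qed

section \<open>Masses of the transform over the time-frequency plane\<close>

definition STFT :: "(real \<Rightarrow> complex) \<Rightarrow> real \<Rightarrow> real \<Rightarrow> complex" where
  "STFT f q p = fourier_L1 (\<lambda>t. f t * of_real (gwin (t - q))) p"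

lemma borel_measurable_STFT:
  assumes [measurable]: "f \<in> borel_measurable borel"
  shows "case_prod (STFT f) \<in> borel_measurable (lborel \<Otimes>\<^sub>M lborel)"
proof -
  have "(\<lambda>x. LINT t|lborel. f t * of_real (gwin (t - fst x)) * echar (t * snd x))
      \<in> borel_measurable (lborel \<Otimes>\<^sub>M lborel)"
    by (rule lborel.borel_measurable_lebesgue_integral) measurable
  then show ?thesis by (simp add: STFT_def fourier_L1_echar case_prod_beta')
qed

lemma borel_measurable_STFT' [measurable (raw)]:
  assumes [measurable]: "f \<in> borel_measurable borel" "g \<in> borel_measurable M" "h \<in> borel_measurable M"
  shows "(\<lambda>x. STFT f (g x) (h x)) \<in> borel_measurable M"
proof -
  have "(\<lambda>x. (g x, h x)) \<in> M \<rightarrow>\<^sub>M lborel \<Otimes>\<^sub>M lborel" by measurable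
  from measurable_compose[OF this borel_measurable_STFT[OF assms(1)]] show ?thesis by simp
qed

text \<open>Plancherel's theorem in \<open>p\<close> for fixed \<open>q\<close>: the product of
  \<open>f\<close> and the window is in L^2 because the window is bounded, and in L^1 because both
  factors are in L^2.\<close>

lemma STFT_marginal:
  assumes f: "f \<in> L2_fun"
  shows "(\<integral>\<^sup>+ p. ennreal ((cmod (STFT f q p))\<^sup>2) \<partial>lborel) =
    (\<integral>\<^sup>+ t. ennreal ((cmod (f t))\<^sup>2) * ennreal ((gwin (t - q))\<^sup>2) \<partial>lborel)"
proof -
  note [measurable] = f[THEN L2_fun_measurable]
  let ?h = "\<lambda>t. f t * of_real (gwin (t - q))"
  have "integrable lborel ?h"
    using L2_mult_integrable[OF f gwin_L2[of q 0 0]] by simp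
  moreover have "?h \<in> L2_fun"
  proof -
    have "integrable lborel (\<lambda>t. sqrt 2 * (cmod (f t))\<^sup>2)" using f by (simp add: L2_fun_def)
    then have "integrable lborel (\<lambda>t. (cmod (?h t))\<^sup>2)"
    proof (rule Bochner_Integration.integrable_bound)
      have "(gwin (t - q))\<^sup>2 \<le> (sqrt (sqrt 2))\<^sup>2" for t
        by (intro power_mono gwin_le gwin_nonneg)
      then show "AE t in lborel. norm ((cmod (?h t))\<^sup>2) \<le> norm (sqrt 2 * (cmod (f t))\<^sup>2)"
        by (auto simp: norm_mult power_mult_distrib mult.commute[of "sqrt 2"] intro!: mult_left_mono)
    qed measurable
    then show ?thesis by (simp add: L2_fun_def)
  qed
  ultimately have "L2_nsq (fourier_L1 ?h) = L2_nsq ?h" by (rule Plancherel_L1_L2)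
  then show ?thesis
    by (simp add: L2_nsq_def STFT_def norm_mult power_mult_distrib ennreal_mult)
qed

text \<open>Tonelli's theorem: a weight in \<open>q\<close> turns into its convolution with the
  squared window. The weight 1 will give the mass, the weight q^2 the second moment.\<close>

lemma STFT_weighted_mass:
  assumes f: "f \<in> L2_fun" and [measurable]: "w \<in> borel_measurable borel"
  shows "(\<integral>\<^sup>+ q. \<integral>\<^sup>+ p. w q * ennreal ((cmod (STFT f q p))\<^sup>2) \<partial>lborel \<partial>lborel) =
    (\<integral>\<^sup>+ t. ennreal ((cmod (f t))\<^sup>2) * (\<integral>\<^sup>+ q. w q * ennreal ((gwin (t - q))\<^sup>2) \<partial>lborel) \<partial>lborel)"
proof -
  note [measurable] = f[THEN L2_fun_measurable]
  have "(\<integral>\<^sup>+ q. \<integral>\<^sup>+ p. w q * ennreal ((cmod (STFT f q p))\<^sup>2) \<partial>lborel \<partial>lborel) =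
      (\<integral>\<^sup>+ q. w q * (\<integral>\<^sup>+ t. ennreal ((cmod (f t))\<^sup>2) * ennreal ((gwin (t - q))\<^sup>2) \<partial>lborel) \<partial>lborel)"
    by (simp add: nn_integral_cmult STFT_marginal[OF f])
  also have "\<dots> = (\<integral>\<^sup>+ q. \<integral>\<^sup>+ t. ennreal ((cmod (f t))\<^sup>2) * (w q * ennreal ((gwin (t - q))\<^sup>2)) \<partial>lborel \<partial>lborel)"
    by (simp add: nn_integral_cmult[symmetric] ac_simps)
  also have "\<dots> = (\<integral>\<^sup>+ t. \<integral>\<^sup>+ q. ennreal ((cmod (f t))\<^sup>2) * (w q * ennreal ((gwin (t - q))\<^sup>2)) \<partial>lborel \<partial>lborel)"
    by (rule lborel_pair.Fubini') measurable
  also have "\<dots> = (\<integral>\<^sup>+ t. ennreal ((cmod (f t))\<^sup>2) * (\<integral>\<^sup>+ q. w q * ennreal ((gwin (t - q))\<^sup>2) \<partial>lborel) \<partial>lborel)"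
    by (simp add: nn_integral_cmult)
  finally show ?thesis .
qed

text \<open>The window being its own transform, the Fourier transform acts on the time-frequency
  plane as a quarter turn. The turn costs a phase, hence the moduli.\<close>

lemma STFT_fourier:
  assumes f: "f \<in> L2_fun" and g: "has_fourier_L2 f g"
  shows "cmod (STFT f q p) = cmod (STFT g p (- q))"
proof -
  \<comment> \<open>The phase is normalised so that the transform of \<open>?h\<close> is exactly
    the window at \<open>q\<close> modulated by \<open>p\<close>.\<close>
  let ?h = "\<lambda>\<xi>. of_real (gwin (\<xi> - p)) * echar (- (q * (\<xi> - p)))"
  have h: "?h = (\<lambda>\<xi>. of_real (gwin (\<xi> - p)) * echar ((- q) * \<xi> + q * p))"
    by (simp add: algebra_simps)
  have h1: "integrable lborel ?h" unfolding h by (rule gwin_L1)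
  have h2: "?h \<in> L2_fun" unfolding h by (rule gwin_L2)
  have "STFT g p (- q) = (LINT \<xi>|lborel. echar (- (q * p)) * (g \<xi> * ?h \<xi>))"
    unfolding STFT_def fourier_L1_echar
    by (intro Bochner_Integration.integral_cong refl)
      (simp add: ac_simps flip: echar_add, simp add: algebra_simps)
  also have "\<dots> = echar (- (q * p)) * (LINT t|lborel. f t * fourier_L1 ?h t)"
    using has_fourier_L2_multiplication[OF f g h1 h2] by simp
  also have "(LINT t|lborel. f t * fourier_L1 ?h t) = STFT f q p"
    unfolding STFT_def fourier_L1_echar[of _ p] fourier_L1_gwin
      fourier_L1_translate_modulate[of "\<lambda>x. of_real (gwin x)" p q]
    by (simp only: mult.assoc mult.left_commute mult.commute)
  finally show ?thesis by (simp add: norm_mult)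
qed

text \<open>By the quarter turn a weight in frequency becomes a weight in the first variable of
  \<open>STFT g\<close>; exchanging the integrals and reflecting \<open>q\<close> leads back to
  \<open>STFT_weighted_mass\<close>.\<close>

lemma STFT_weighted_mass_fourier:
  assumes f: "f \<in> L2_fun" and g: "has_fourier_L2 f g" and [measurable]: "w \<in> borel_measurable borel"
  shows "(\<integral>\<^sup>+ q. \<integral>\<^sup>+ p. w p * ennreal ((cmod (STFT f q p))\<^sup>2) \<partial>lborel \<partial>lborel) =
    (\<integral>\<^sup>+ \<xi>. ennreal ((cmod (g \<xi>))\<^sup>2) * (\<integral>\<^sup>+ p. w p * ennreal ((gwin (\<xi> - p))\<^sup>2) \<partial>lborel) \<partial>lborel)"
proof -
  have g2: "g \<in> L2_fun" using g by (simp add: has_fourier_L2_def)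
  note [measurable] = f[THEN L2_fun_measurable] g2[THEN L2_fun_measurable]
  have "(\<integral>\<^sup>+ q. \<integral>\<^sup>+ p. w p * ennreal ((cmod (STFT f q p))\<^sup>2) \<partial>lborel \<partial>lborel) =
      (\<integral>\<^sup>+ p. \<integral>\<^sup>+ q. w p * ennreal ((cmod (STFT g p (- q)))\<^sup>2) \<partial>lborel \<partial>lborel)"
    unfolding STFT_fourier[OF f g] by (rule lborel_pair.Fubini') measurable
  also have "\<dots> = (\<integral>\<^sup>+ p. \<integral>\<^sup>+ q. w p * ennreal ((cmod (STFT g p q))\<^sup>2) \<partial>lborel \<partial>lborel)"
  proof (rule nn_integral_cong)
    fix p
    show "(\<integral>\<^sup>+ q. w p * ennreal ((cmod (STFT g p (- q)))\<^sup>2) \<partial>lborel) =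
        (\<integral>\<^sup>+ q. w p * ennreal ((cmod (STFT g p q))\<^sup>2) \<partial>lborel)"
      using nn_integral_real_affine[of "\<lambda>q. w p * ennreal ((cmod (STFT g p q))\<^sup>2)" "-1" 0] by simp
  qed
  finally show ?thesis unfolding STFT_weighted_mass[OF g2 assms(3)] .
qed

text \<open>Plancherel's theorem on L^2: the total mass of the short-time transform, computed once
  from \<open>f\<close> and once from \<open>g\<close>.\<close>

lemma has_fourier_L2_nsq:
  assumes f: "f \<in> L2_fun" and g: "has_fourier_L2 f g"
  shows "L2_nsq g = L2_nsq f"
  using STFT_weighted_mass[OF f, of "\<lambda>_. 1"] STFT_weighted_mass_fourier[OF f g, of "\<lambda>_. 1"]
  by (simp add: nn_integral_gwin_sq L2_nsq_def)

section \<open>Bessel's inequality and the bathtub bound\<close>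

lemma L2_inner_integrable:
  assumes "f \<in> L2_fun" "g \<in> L2_fun"
  shows "integrable lborel (\<lambda>t. f t * cnj (g t))"
  using L2_mult_integrable[OF assms(1) L2_fun_cnj[OF assms(2)]] .

lemma L2_inner_commute: "L2_inner g f = cnj (L2_inner f g)"
  unfolding L2_inner_def Bochner_Integration.integral_cnj[symmetric] by (simp add: mult.commute)

lemma L2_inner_self: "L2_inner f f = of_real (LINT t|lborel. (cmod (f t))\<^sup>2)"
  unfolding L2_inner_def complex_norm_square[symmetric] by (rule integral_complex_of_real)

lemma L2_inner_diff_left:
  assumes "f \<in> L2_fun" "g \<in> L2_fun" "h \<in> L2_fun"
  shows "L2_inner (\<lambda>t. f t - g t) h = L2_inner f h - L2_inner g h"
  unfolding L2_inner_def left_diff_distrib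
  using assms by (intro Bochner_Integration.integral_diff L2_inner_integrable)

lemma L2_inner_sum_left:
  assumes "\<And>k. k \<in> K \<Longrightarrow> e k \<in> L2_fun" "h \<in> L2_fun"
  shows "L2_inner (\<lambda>t. \<Sum>k\<in>K. c k * e k t) h = (\<Sum>k\<in>K. c k * L2_inner (e k) h)"
proof -
  have "L2_inner (\<lambda>t. \<Sum>k\<in>K. c k * e k t) h = (LINT t|lborel. (\<Sum>k\<in>K. c k * (e k t * cnj (h t))))"
    by (simp add: L2_inner_def sum_distrib_right mult.assoc)
  also have "\<dots> = (\<Sum>k\<in>K. LINT t|lborel. c k * (e k t * cnj (h t)))"
    using assms by (intro Bochner_Integration.integral_sum integrable_mult_right L2_inner_integrable)
  finally show ?thesis by (simp add: L2_inner_def)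
qed

lemma L2_fun_sum:
  assumes "finite K" "\<And>k. k \<in> K \<Longrightarrow> e k \<in> L2_fun"
  shows "(\<lambda>t. \<Sum>k\<in>K. c k * e k t) \<in> L2_fun"
  using assms
proof (induction K)
  case empty
  show ?case by (simp add: L2_fun_def)
next
  case (insert x K)
  then show ?case by (auto intro!: L2_fun_add L2_fun_cmult)
qed

lemma L2_Bessel:
  assumes K: "finite K" and e: "\<And>k. k \<in> K \<Longrightarrow> e k \<in> L2_fun" and w: "w \<in> L2_fun"
    and orth: "\<And>k l. k \<in> K \<Longrightarrow> l \<in> K \<Longrightarrow> L2_inner (e k) (e l) = (if k = l then 1 else 0)"
  shows "(\<Sum>k\<in>K. (cmod (L2_inner (e k) w))\<^sup>2) \<le> (LINT t|lborel. (cmod (w t))\<^sup>2)"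
proof -
  \<comment> \<open>\<open>p\<close> is the orthogonal projection of \<open>w\<close> onto the span
    of the \<open>e k\<close>; the inequality is the nonnegativity of the squared norm of the
    residual \<open>r\<close>.\<close>
  define p where "p t = (\<Sum>k\<in>K. L2_inner w (e k) * e k t)" for t
  define r where "r t = w t - p t" for t
  have p: "p \<in> L2_fun" unfolding p_def using K e by (rule L2_fun_sum)
  have r: "r \<in> L2_fun" unfolding r_def using w p by (rule L2_fun_diff)
  have "L2_inner p (e l) = L2_inner w (e l)" if "l \<in> K" for l
  proof -
    have "L2_inner p (e l) = (\<Sum>k\<in>K. L2_inner w (e k) * L2_inner (e k) (e l))"
      unfolding p_def using e that by (intro L2_inner_sum_left) auto
    also have "\<dots> = (\<Sum>k\<in>K. if k = l then L2_inner w (e k) else 0)"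
      using that orth by (intro sum.cong) auto
    finally show ?thesis using K that by simp
  qed
  then have "L2_inner r (e l) = 0" if "l \<in> K" for l
    using that e w p by (simp add: r_def[abs_def] L2_inner_diff_left)
  then have "L2_inner (e l) r = 0" if "l \<in> K" for l
    using that L2_inner_commute[of "e l" r] by simp
  then have "L2_inner p r = 0"
    unfolding p_def using e r by (simp add: L2_inner_sum_left)
  then have "L2_inner r r = L2_inner w r"
    using w p r L2_inner_diff_left[OF w p r] by (simp add: r_def[abs_def])
  also have "\<dots> = cnj (L2_inner r w)" by (rule L2_inner_commute)
  also have "L2_inner r w = L2_inner w w - L2_inner p w"
    using w p by (simp add: r_def[abs_def] L2_inner_diff_left)
  also have "L2_inner p w = (\<Sum>k\<in>K. L2_inner w (e k) * L2_inner (e k) w)"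
    unfolding p_def using e w by (rule L2_inner_sum_left)
  also have "\<dots> = of_real (\<Sum>k\<in>K. (cmod (L2_inner (e k) w))\<^sup>2)"
    unfolding of_real_sum complex_norm_square
    by (intro sum.cong refl) (simp add: L2_inner_commute[of w] mult.commute)
  finally have "complex_of_real (LINT t|lborel. (cmod (r t))\<^sup>2) =
      of_real ((LINT t|lborel. (cmod (w t))\<^sup>2) - (\<Sum>k\<in>K. (cmod (L2_inner (e k) w))\<^sup>2))"
    unfolding L2_inner_self by (simp only: of_real_diff[symmetric] complex_cnj_complex_of_real)
  then have "(LINT t|lborel. (cmod (r t))\<^sup>2) =
      (LINT t|lborel. (cmod (w t))\<^sup>2) - (\<Sum>k\<in>K. (cmod (L2_inner (e k) w))\<^sup>2)"
    by (simp only: of_real_eq_iff)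
  moreover have "(LINT t|lborel. (cmod (r t))\<^sup>2) \<ge> 0" by simp
  ultimately show ?thesis by linarith
qed

lemma STFT_Bessel:
  assumes "finite K" "\<And>k. k \<in> K \<Longrightarrow> e k \<in> L2_fun"
    and "\<And>k l. k \<in> K \<Longrightarrow> l \<in> K \<Longrightarrow> L2_inner (e k) (e l) = (if k = l then 1 else 0)"
  shows "(\<Sum>k\<in>K. (cmod (STFT (e k) q p))\<^sup>2) \<le> 1"
proof -
  \<comment> \<open>A unit vector whose inner products with the \<open>e k\<close> are the values of
    \<open>STFT\<close>; the frequency is \<open>- p\<close> because \<open>L2_inner\<close>
    conjugates its second argument.\<close>
  let ?w = "\<lambda>t. of_real (gwin (t - q)) * echar ((- p) * t + 0)"
  have w: "?w \<in> L2_fun" by (rule gwin_L2)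
  have STFT: "STFT (e k) q p = L2_inner (e k) ?w" for k
    by (simp add: STFT_def fourier_L1_echar L2_inner_def cnj_echar ac_simps)
  have "L2_nsq ?w = (\<integral>\<^sup>+ t. ennreal ((gwin (q - t))\<^sup>2) \<partial>lborel)"
    by (simp add: L2_nsq_def norm_mult gwin_def gauss_def power2_commute[of q])
  then have "ennreal (LINT t|lborel. (cmod (?w t))\<^sup>2) = 1"
    using L2_nsq_eq_integral[OF w] nn_integral_gwin_sq[of q] by simp
  then have "(LINT t|lborel. (cmod (?w t))\<^sup>2) = 1" by simp
  then show ?thesis
    unfolding STFT using L2_Bessel[OF assms(1,2) w assms(3)] by simp
qed

section \<open>Second moments and the volume under a paraboloid\<close>

lemma second_moment_bound:
  assumes f: "f \<in> L2_fun" and nsq: "L2_nsq f = 1" and fin: "finite_mean_variance f"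
    and mean: "\<bar>L2_mean f\<bar> \<le> A" and disp: "dispersion f \<le> A" and c: "c \<ge> 0"
  shows "(\<integral>\<^sup>+ t. ennreal ((cmod (f t))\<^sup>2) * ennreal (t\<^sup>2 + c) \<partial>lborel) \<le> ennreal (2 * A\<^sup>2 + c)"
proof -
  let ?m = "L2_mean f" and ?n = "\<lambda>t. (cmod (f t))\<^sup>2"
  have "integrable lborel ?n" using f by (simp add: L2_fun_def)
  moreover have "(LINT t|lborel. ?n t) = 1"
    using L2_nsq_eq_integral[OF f] nsq by simp
  ultimately have 0: "has_bochner_integral lborel ?n 1" by (simp add: has_bochner_integral_iff)
  have 1: "has_bochner_integral lborel (\<lambda>t. t * ?n t) ?m"
    using fin by (simp add: has_bochner_integral_iff finite_mean_variance_def L2_mean_def)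
  have 2: "has_bochner_integral lborel (\<lambda>t. \<bar>t - ?m\<bar>\<^sup>2 * ?n t) (L2_variance f)"
    using fin by (simp add: has_bochner_integral_iff finite_mean_variance_def L2_variance_def)
  \<comment> \<open>The second moment about 0 is variance plus squared mean: t^2 + c = (t - m)^2 + 2
    m t + (c - m^2), integrated term by term. In the application \<open>c\<close> is the variance of
    the squared window.\<close>
  have "has_bochner_integral lborel (\<lambda>t. \<bar>t - ?m\<bar>\<^sup>2 * ?n t + 2 * ?m * (t * ?n t) + (c - ?m\<^sup>2) * ?n t)
      (L2_variance f + 2 * ?m * ?m + (c - ?m\<^sup>2) * 1)"
    by (intro has_bochner_integral_add has_bochner_integral_mult_right 0 1 2)
  moreover have "\<bar>t - ?m\<bar>\<^sup>2 * ?n t + 2 * ?m * (t * ?n t) + (c - ?m\<^sup>2) * ?n t = ?n t * (t\<^sup>2 + c)" for t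
    unfolding power2_abs by (simp add: power2_diff algebra_simps power2_eq_square)
  moreover have "L2_variance f + 2 * ?m * ?m + (c - ?m\<^sup>2) * 1 = L2_variance f + ?m\<^sup>2 + c"
    by (simp add: power2_eq_square)
  ultimately have "has_bochner_integral lborel (\<lambda>t. ?n t * (t\<^sup>2 + c)) (L2_variance f + ?m\<^sup>2 + c)"
    by (simp only:)
  then have "(\<integral>\<^sup>+ t. ennreal (?n t * (t\<^sup>2 + c)) \<partial>lborel) = ennreal (L2_variance f + ?m\<^sup>2 + c)"
    using c by (subst nn_integral_eq_integral) (auto simp: has_bochner_integral_iff)
  moreover have "L2_variance f \<le> A\<^sup>2"
  proof -
    have "L2_variance f \<ge> 0" by (simp add: L2_variance_def)
    then have "L2_variance f = (dispersion f)\<^sup>2" "0 \<le> dispersion f" by (auto simp: dispersion_def)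
    then show ?thesis using disp by (simp add: power_mono)
  qed
  moreover have "?m\<^sup>2 \<le> A\<^sup>2"
    using mean by (metis abs_ge_zero power2_abs power_mono)
  ultimately have "(\<integral>\<^sup>+ t. ennreal (?n t * (t\<^sup>2 + c)) \<partial>lborel) \<le> ennreal (2 * A\<^sup>2 + c)"
    by (auto intro!: ennreal_leI simp del: ennreal_plus)
  then show ?thesis by (simp only: ennreal_mult'[OF zero_le_power2])
qed

text \<open>Discs of radius \<open>sqrt s\<close> have area \<pi> s, integrated over s from 0 to
  \<open>r\<close>. This volume is the loss term of the bathtub estimate in the theorem.\<close>

lemma nn_integral_paraboloid:
  assumes r: "r \<ge> 0"
  shows "(\<integral>\<^sup>+ q. \<integral>\<^sup>+ p. ennreal (max 0 (r - (q\<^sup>2 + p\<^sup>2))) \<partial>lborel \<partial>lborel) = ennreal (pi * r\<^sup>2 / 2)"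
proof -
  \<comment> \<open>Layer cake: the superlevel sets are discs, whose area is known.\<close>
  have layer: "ennreal (max 0 (r - y)) = (\<integral>\<^sup>+ s. indicator {y..r} s \<partial>lborel)" for y :: real
    by (simp add: emeasure_lborel_Icc_eq max_def)
  have "(\<integral>\<^sup>+ q. \<integral>\<^sup>+ p. ennreal (max 0 (r - (q\<^sup>2 + p\<^sup>2))) \<partial>lborel \<partial>lborel) =
      (\<integral>\<^sup>+ x. ennreal (max 0 (r - (norm x)\<^sup>2)) \<partial>(lborel :: (real \<times> real) measure))"
    unfolding lborel_prod[symmetric]
    by (subst lborel.nn_integral_fst[symmetric]) (auto simp: norm_prod_def)
  also have "\<dots> = (\<integral>\<^sup>+ x. \<integral>\<^sup>+ s. indicator {(norm (x :: real \<times> real))\<^sup>2..r} s \<partial>lborel \<partial>lborel)"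
    unfolding layer ..
  also have "\<dots> = (\<integral>\<^sup>+ s. \<integral>\<^sup>+ x. indicator {(norm (x :: real \<times> real))\<^sup>2..r} s \<partial>lborel \<partial>lborel)"
    by (rule lborel_pair.Fubini') (unfold indicator_def atLeastAtMost_iff, measurable)
  also have "\<dots> = (\<integral>\<^sup>+ s. ennreal (pi * s) * indicator {0..r} s \<partial>lborel)"
  proof (rule nn_integral_cong)
    fix s :: real
    \<comment> \<open>The section at level \<open>s\<close> is the disc of radius
      \<open>sqrt s\<close>, and empty for negative \<open>s\<close>, whence the lower end 0 of the
      interval.\<close>
    have eq: "indicator {(norm x)\<^sup>2..r} s = (indicator {0..r} s * indicator (cball 0 (sqrt s)) x :: ennreal)"
      for x :: "real \<times> real"
    proof -
      have "norm x \<le> sqrt s \<longleftrightarrow> (norm x)\<^sup>2 \<le> s"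
        using real_le_rsqrt real_sqrt_le_iff[of "(norm x)\<^sup>2" s] by auto
      moreover have "0 \<le> s" if "(norm x)\<^sup>2 \<le> s" using zero_le_power2 that by (rule order_trans)
      ultimately show ?thesis by (auto split: split_indicator)
    qed
    have "(\<integral>\<^sup>+ x. indicator {(norm (x :: real \<times> real))\<^sup>2..r} s \<partial>lborel) =
        indicator {0..r} s * emeasure lborel (cball (0 :: real \<times> real) (sqrt s))"
      unfolding eq by (rule nn_integral_cmult_indicator) simp
    also have "\<dots> = ennreal (pi * s) * indicator {0..r} s"
    proof (cases "s \<in> {0..r}")
      case True
      then have "emeasure lborel (cball (0 :: real \<times> real) (sqrt s)) = ennreal (pi * s)"
        by (subst emeasure_cball) (auto simp: unit_ball_vol_2)
      then show ?thesis by (simp add: mult.commute)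
    qed simp
    finally show "(\<integral>\<^sup>+ x. indicator {(norm (x :: real \<times> real))\<^sup>2..r} s \<partial>lborel) =
        ennreal (pi * s) * indicator {0..r} s" .
  qed
  also have "\<dots> = ennreal (pi * r\<^sup>2 / 2 - pi * 0\<^sup>2 / 2)"
    using r by (intro nn_integral_FTC_Icc) (auto intro!: derivative_eq_intros)
  finally show ?thesis by simp
qed

section \<open>Comparison of second moments over the time-frequency plane\<close>

theorem corollary2p5:
  fixes A :: real and n :: nat and e :: "nat \<Rightarrow> real \<Rightarrow> complex"
  assumes "A > 0"
    and "\<And>k. k \<le> n \<Longrightarrow> e k \<in> L2_fun"
    and "\<And>k l. k \<le> n \<Longrightarrow> l \<le> n \<Longrightarrow> L2_inner (e k) (e l) = (if k = l then 1 else 0)"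
    and "\<And>k. k \<le> n \<Longrightarrow> finite_mean_variance (e k)"
    and "\<And>k. k \<le> n \<Longrightarrow> finite_mean_variance (fourier_L2 (e k))"
    and "\<And>k. k \<le> n \<Longrightarrow> \<bar>L2_mean (e k)\<bar> \<le> A"
    and "\<And>k. k \<le> n \<Longrightarrow> \<bar>L2_mean (fourier_L2 (e k))\<bar> \<le> A"
    and "\<And>k. k \<le> n \<Longrightarrow> dispersion (e k) \<le> A"
    and "\<And>k. k \<le> n \<Longrightarrow> dispersion (fourier_L2 (e k)) \<le> A"
  shows "real n \<le> 8 * pi * A\<^sup>2"
proof -
  define r where "r = real (n + 1) / pi"
  have r: "r > 0" by (simp add: r_def)
  define d where "d k q p = (cmod (STFT (e k) q p))\<^sup>2" for k q p
  \<comment> \<open>Squared mean and variance contribute at most \<open>A\<close>^2 each, the window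
    its variance.\<close>
  define M where "M = 2 * A\<^sup>2 + 1 / (4 * pi)"
  have M: "M \<ge> 0" by (simp add: M_def)
  have [measurable]: "e k \<in> borel_measurable borel" if "k \<in> {..n}" for k
    using assms(2) that by (auto intro: L2_fun_measurable)
  have nsq: "L2_nsq (e k) = 1" if "k \<le> n" for k
  proof -
    have "(LINT t|lborel. (cmod (e k t))\<^sup>2) = 1"
      using assms(3)[OF that that] unfolding L2_inner_self by (simp only: of_real_eq_1_iff if_True refl)
    then show ?thesis using L2_nsq_eq_integral[OF assms(2)[OF that]] by simp
  qed
  have mass: "(\<integral>\<^sup>+ q. \<integral>\<^sup>+ p. ennreal (d k q p) \<partial>lborel \<partial>lborel) = 1" if "k \<le> n" for k
    using STFT_weighted_mass[OF assms(2)[OF that], of "\<lambda>_. 1"] nsq[OF that]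
    by (simp add: d_def nn_integral_gwin_sq L2_nsq_def)
  have mq: "(\<integral>\<^sup>+ q. \<integral>\<^sup>+ p. ennreal (q\<^sup>2) * ennreal (d k q p) \<partial>lborel \<partial>lborel) \<le> ennreal M" if "k \<le> n" for k
    unfolding d_def STFT_weighted_mass[OF assms(2)[OF that], of "\<lambda>q. ennreal (q\<^sup>2)", simplified]
      nn_integral_second_moment_gwin_sq M_def
    using that by (intro second_moment_bound assms nsq) auto
  \<comment> \<open>For the frequency weight the transform of \<open>e k\<close> takes the place of
    \<open>e k\<close>; it too has unit norm, so the same moment bound applies.\<close>
  have mp: "(\<integral>\<^sup>+ q. \<integral>\<^sup>+ p. ennreal (p\<^sup>2) * ennreal (d k q p) \<partial>lborel \<partial>lborel) \<le> ennreal M" if "k \<le> n" for k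
  proof -
    have F: "has_fourier_L2 (e k) (fourier_L2 (e k))"
      using assms(2)[OF that] by (rule has_fourier_L2_fourier_L2)
    have "L2_nsq (fourier_L2 (e k)) = 1"
      using has_fourier_L2_nsq[OF assms(2)[OF that] F] nsq[OF that] by simp
    moreover have "fourier_L2 (e k) \<in> L2_fun" using F by (simp add: has_fourier_L2_def)
    ultimately show ?thesis
      unfolding d_def STFT_weighted_mass_fourier[OF assms(2)[OF that] F, of "\<lambda>p. ennreal (p\<^sup>2)", simplified]
        nn_integral_second_moment_gwin_sq M_def
      using that by (intro second_moment_bound assms) auto
  qed
  \<comment> \<open>The bathtub principle, with \<open>r\<close> the squared radius of the disc of area \<open>n + 1\<close>.\<close>
  have pw: "r * (\<Sum>k\<le>n. d k q p) \<le> (\<Sum>k\<le>n. q\<^sup>2 * d k q p + p\<^sup>2 * d k q p) + max 0 (r - (q\<^sup>2 + p\<^sup>2))" for q p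
  proof -
    let ?Q = "\<Sum>k\<le>n. d k q p"
    have "0 \<le> ?Q" "?Q \<le> 1"
      using STFT_Bessel[of "{..n}" e q p] assms(2,3) by (auto simp: d_def intro: sum_nonneg)
    \<comment> \<open>Inside the disc \<open>?Q\<close> is bounded by 1; outside it the left side is
      not positive because \<open>?Q\<close> is nonnegative.\<close>
    then have "(r - (q\<^sup>2 + p\<^sup>2)) * ?Q \<le> max 0 (r - (q\<^sup>2 + p\<^sup>2)) * 1"
      by (intro mult_mono) auto
    moreover have "(\<Sum>k\<le>n. q\<^sup>2 * d k q p + p\<^sup>2 * d k q p) = (q\<^sup>2 + p\<^sup>2) * ?Q"
      by (simp add: sum_distrib_left distrib_right)
    ultimately show ?thesis by (simp add: algebra_simps)
  qed
  \<comment> \<open>Iterated integrals are rewritten as integrals over the plane, so that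
    \<open>pw\<close> can be integrated and split term by term.\<close>
  let ?P = "lborel \<Otimes>\<^sub>M lborel :: (real \<times> real) measure"
  have iter: "(\<integral>\<^sup>+ x. F (fst x) (snd x) \<partial>?P) = (\<integral>\<^sup>+ q. \<integral>\<^sup>+ p. F q p \<partial>lborel \<partial>lborel)"
    if "case_prod F \<in> borel_measurable ?P" for F
    using lborel.nn_integral_fst[OF that] by (simp add: case_prod_beta')
  define D where "D k x = d k (fst x) (snd x)" for k x
  have D_nonneg: "D k x \<ge> 0" for k x by (simp add: D_def d_def)
  have D_measurable: "(\<lambda>x. D k x) \<in> borel_measurable ?P" if "k \<in> {..n}" for k
    using that unfolding D_def d_def by measurable
  have D_mass: "(\<integral>\<^sup>+ x. ennreal (D k x) \<partial>?P) = 1" if "k \<le> n" for k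
    using D_measurable[of k] that unfolding D_def
    by (subst iter) (auto simp: mass case_prod_beta')
  have D_q: "(\<integral>\<^sup>+ x. ennreal ((fst x)\<^sup>2) * ennreal (D k x) \<partial>?P) \<le> ennreal M" if "k \<le> n" for k
    using D_measurable[of k] that unfolding D_def
    by (subst iter[of "\<lambda>q p. ennreal (q\<^sup>2) * ennreal (d k q p)"]) (auto simp: mq case_prod_beta')
  have D_p: "(\<integral>\<^sup>+ x. ennreal ((snd x)\<^sup>2) * ennreal (D k x) \<partial>?P) \<le> ennreal M" if "k \<le> n" for k
    using D_measurable[of k] that unfolding D_def
    by (subst iter[of "\<lambda>q p. ennreal (p\<^sup>2) * ennreal (d k q p)"]) (auto simp: mp case_prod_beta')
  have paraboloid: "(\<integral>\<^sup>+ x. ennreal (max 0 (r - ((fst x)\<^sup>2 + (snd x)\<^sup>2))) \<partial>?P) = ennreal (pi * r\<^sup>2 / 2)"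
    using r by (subst iter[of "\<lambda>q p. ennreal (max 0 (r - (q\<^sup>2 + p\<^sup>2)))"])
      (measurable, simp only: nn_integral_paraboloid less_imp_le)
  \<comment> \<open>\<open>pw\<close> is integrated over the plane. Every \<open>D k\<close> has
    mass 1, so the left side gives \<open>r\<close> times n + 1.\<close>
  have "ennreal (r * real (n + 1)) = ennreal r * (\<Sum>k\<le>n. \<integral>\<^sup>+ x. ennreal (D k x) \<partial>?P)"
    using r by (simp add: D_mass ennreal_mult ennreal_of_nat_eq_real_of_nat)
  also have "\<dots> = (\<integral>\<^sup>+ x. ennreal r * (\<Sum>k\<le>n. ennreal (D k x)) \<partial>?P)"
  proof -
    have "(\<Sum>k\<le>n. \<integral>\<^sup>+ x. ennreal (D k x) \<partial>?P) = (\<integral>\<^sup>+ x. (\<Sum>k\<le>n. ennreal (D k x)) \<partial>?P)"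
      by (rule nn_integral_sum[symmetric]) (intro measurable_compose[OF D_measurable measurable_ennreal])
    then show ?thesis
      by (subst nn_integral_cmult)
        (auto intro!: borel_measurable_sum measurable_compose[OF D_measurable measurable_ennreal])
  qed
  also have "\<dots> \<le> (\<integral>\<^sup>+ x. (\<Sum>k\<le>n. ennreal ((fst x)\<^sup>2) * ennreal (D k x) + ennreal ((snd x)\<^sup>2) * ennreal (D k x))
      + ennreal (max 0 (r - ((fst x)\<^sup>2 + (snd x)\<^sup>2))) \<partial>?P)"
  proof (rule nn_integral_mono)
    fix x :: "real \<times> real"
    have "ennreal r * (\<Sum>k\<le>n. ennreal (D k x)) = ennreal (r * (\<Sum>k\<le>n. D k x))"
      using r D_nonneg by (simp add: sum_nonneg ennreal_mult)
    also have "\<dots> \<le> ennreal ((\<Sum>k\<le>n. (fst x)\<^sup>2 * D k x + (snd x)\<^sup>2 * D k x)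
        + max 0 (r - ((fst x)\<^sup>2 + (snd x)\<^sup>2)))"
      unfolding D_def by (intro ennreal_leI pw)
    also have "\<dots> = ennreal (\<Sum>k\<le>n. (fst x)\<^sup>2 * D k x + (snd x)\<^sup>2 * D k x)
        + ennreal (max 0 (r - ((fst x)\<^sup>2 + (snd x)\<^sup>2)))"
      using D_nonneg by (intro ennreal_plus sum_nonneg) auto
    also have "ennreal (\<Sum>k\<le>n. (fst x)\<^sup>2 * D k x + (snd x)\<^sup>2 * D k x) =
        (\<Sum>k\<le>n. ennreal ((fst x)\<^sup>2) * ennreal (D k x) + ennreal ((snd x)\<^sup>2) * ennreal (D k x))"
      using D_nonneg by (subst sum_ennreal[symmetric]) (auto simp: ennreal_mult)
    finally show "ennreal r * (\<Sum>k\<le>n. ennreal (D k x)) \<le>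
        (\<Sum>k\<le>n. ennreal ((fst x)\<^sup>2) * ennreal (D k x) + ennreal ((snd x)\<^sup>2) * ennreal (D k x))
        + ennreal (max 0 (r - ((fst x)\<^sup>2 + (snd x)\<^sup>2)))" .
  qed
  also have "\<dots> = (\<Sum>k\<le>n. (\<integral>\<^sup>+ x. ennreal ((fst x)\<^sup>2) * ennreal (D k x) \<partial>?P)
        + (\<integral>\<^sup>+ x. ennreal ((snd x)\<^sup>2) * ennreal (D k x) \<partial>?P))
      + (\<integral>\<^sup>+ x. ennreal (max 0 (r - ((fst x)\<^sup>2 + (snd x)\<^sup>2))) \<partial>?P)"
  proof -
    let ?a = "\<lambda>k x. ennreal ((fst x)\<^sup>2) * ennreal (D k x)"
    let ?b = "\<lambda>k x. ennreal ((snd x)\<^sup>2) * ennreal (D k x)"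
    have ab: "?a k \<in> borel_measurable ?P" "?b k \<in> borel_measurable ?P" if "k \<in> {..n}" for k
    proof -
      have D: "(\<lambda>x. ennreal (D k x)) \<in> borel_measurable ?P"
        using D_measurable[OF that] by (rule measurable_compose) (rule measurable_ennreal)
      show "?a k \<in> borel_measurable ?P"
        by (rule borel_measurable_times_ennreal[OF _ D]) measurable
      show "?b k \<in> borel_measurable ?P"
        by (rule borel_measurable_times_ennreal[OF _ D]) measurable
    qed
    have sum_measurable: "(\<lambda>x. \<Sum>k\<le>n. ?a k x + ?b k x) \<in> borel_measurable ?P"
      by (rule borel_measurable_sum) (rule borel_measurable_add[OF ab])
    have "(\<integral>\<^sup>+ x. (\<Sum>k\<le>n. ?a k x + ?b k x) \<partial>?P) = (\<Sum>k\<le>n. \<integral>\<^sup>+ x. ?a k x + ?b k x \<partial>?P)"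
      by (rule nn_integral_sum) (rule borel_measurable_add[OF ab])
    also have "\<dots> = (\<Sum>k\<le>n. (\<integral>\<^sup>+ x. ?a k x \<partial>?P) + (\<integral>\<^sup>+ x. ?b k x \<partial>?P))"
      by (intro sum.cong refl nn_integral_add ab)
    finally have sum_eq: "(\<integral>\<^sup>+ x. (\<Sum>k\<le>n. ?a k x + ?b k x) \<partial>?P) = \<dots>" .
    show ?thesis
      unfolding sum_eq[symmetric] by (rule nn_integral_add[OF sum_measurable]) measurable
  qed
  also have "\<dots> \<le> (\<Sum>k\<le>n. ennreal M + ennreal M) + ennreal (pi * r\<^sup>2 / 2)"
    unfolding paraboloid by (intro add_mono sum_mono D_q D_p) auto
  also have "\<dots> = ennreal (real (n + 1) * (2 * M) + pi * r\<^sup>2 / 2)"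
    using M by (simp add: ennreal_plus[symmetric] ennreal_mult' ennreal_of_nat_eq_real_of_nat flip: ennreal_mult' del: ennreal_plus)
  finally have "r * real (n + 1) \<le> real (n + 1) * (2 * M) + pi * r\<^sup>2 / 2"
    using M by (subst (asm) ennreal_le_iff) auto
  \<comment> \<open>\<pi> r = n + 1 by the choice of \<open>r\<close>, so that n + 1 becomes a
    common factor and cancels.\<close>
  also have "pi * r\<^sup>2 / 2 = real (n + 1) * (r / 2)"
    by (simp add: r_def power2_eq_square)
  finally have "real (n + 1) * r \<le> real (n + 1) * (2 * M + r / 2)"
    by (simp only: distrib_left mult.commute)
  then have "r \<le> 2 * M + r / 2" by (rule mult_left_le_imp_le) simp
  then have "r * pi \<le> 4 * M * pi" by (intro mult_right_mono) auto
  moreover have "r * pi = real n + 1" by (simp add: r_def)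
  \<comment> \<open>The variance 1/(4 \<pi>) of the squared window contributes exactly 1, which
    offsets the 1 in n + 1, the number of functions indexed from 0 to \<open>n\<close>.\<close>
  moreover have "4 * M * pi = 8 * pi * A\<^sup>2 + 1" by (simp add: M_def algebra_simps)
  ultimately show ?thesis by linarith
qed

end
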